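(* Let $G$ be a Carnot group. Every monotone subset $E$ of $G$ has locally finite perimeter.
   Context: A Carnot group $G$ is a connected, simply connected Lie group whose Lie algebra $\mathfrak{g}$ of left-invariant vector fields is equipped with a stratification $\mathfrak{g}=\mathfrak{g}_1\oplus\cdots\oplus\mathfrak{g}_s$, i.e. $[\mathfrak{g}_1,\mathfrak{g}_i]=\mathfrak{g}_{i+1}$ for $i=1,\dots,s$, $\mathfrak{g}_s\neq\{0\}$ and $\mathfrak{g}_i=\{0\}$ for $i>s$ (where $[\mathfrak{g}_1,\mathfrak{g}_i]$ is the linear span of brackets). The exponential map $\exp:\mathfrak{g}\to G$ is a smooth diffeomorphism. $\mu$ is a Haar measure on $G$. Lines. A line in $G$ is the unparameterized oriented image of an integral curve of some $X\in\mathfrak{g}_1\setminus\{0\}$, i.e. a set $\{x\cdot\exp(tX): t\in\mathbb{R}\}$ with the orientation given by $X$. Fix a scalar product on $\mathfrak{g}_1$ with unit sphere $\mathbb{S}(\mathfrak{g}_1)$. For $X\in\mathbb{S}(\mathfrak{g}_1)$ let $N_X=\exp(X^\perp)$, where $X^\perp$ is the direct sum of the orthogonal complement of $\mathbb{R}X$ in $\mathfrak{g}_1$ with $\oplus_{i=2}^s\mathfrak{g}_i$; $N_X$ is a subgroup of $G$. Every line can be written uniquely as $\{x\cdot\exp(tX):t\in\mathbb{R}\}$, oriented by $X$, with $X\in\mathbb{S}(\mathfrak{g}_1)$ and $x\in N_X$, so the set of lines is identified with the smooth manifold $\bigsqcup_{X\in\mathbb{S}(\mathfrak{g}_1)}\{X\}\times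 N_X$. A set of lines is null if it has measure zero for some (equivalently any) smooth measure with positive density on this manifold; one such measure is $A\mapsto\int_{\mathbb{S}(\mathfrak{g}_1)}\mu_X(\{x\in N_X:(X,x)\in A\})\,d\sigma(X)$ for Borel $A$ (extended to all sets as an outer measure), where $\sigma$ is the standard measure on the sphere and $\mu_X$ is the Haar measure on $N_X$ normalized so that $(x,t)\mapsto x\cdot\exp(tX)$ is measure preserving from $(N_X\times\mathbb{R},\mu_X\otimes dt)$ to $(G,\mu)$. The notion of null set of lines does not depend on the scalar product. Monotone sets. A line $L$ is monotone for $E\subset G$ if for some (equivalently any) parameterization $t\in\mathbb{R}\mapsto x\cdot\exp(tX)$ of $L$, with $X\in\mathfrak{g}_1\setminus\{0\}$ and $x\in G$ such that $L=\{x\cdot\exp(tX):t\in\mathbb{R}\}$ oriented by $X$, the function $t\mapsto \mathbf{1}_E(x\cdot\exp(tX))$ agrees almost everywhere (for Lebesgue measure on $\mathbb{R}$) with a monotone function. A set $E\subset G$ is monotone if it is $\mu$-measurable and almost every line in $G$ is monotone for $E$. Locally finite perimeter. A set $E\subset G$ has locally finite perimeter if it is $\mu$-measurable and for every $X\in\mathfrak{g}_1$ the distribution $X\mathbf{1}_E$ given by $\langle X\mathbf{1}_E,\varphi\rangle=-\int_E X\varphi\,d\mu$, $\varphi\in C_c^\infty(G)$, is a (signed) Radon measure. *)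

theory Defs
  imports "HOL-Analysis.Analysis"
begin

section \<open>Smooth maps and Lie groups\<close>

text \<open>For open \<open>S\<close> and a finite-dimensional domain, \<open>C_k_on k f S\<close> says that \<open>f\<close> is of class
  $C^k$ on \<open>S\<close>.\<close>

primrec C_k_on ::
  "nat \<Rightarrow> ('v::real_normed_vector \<Rightarrow> 'w::real_normed_vector) \<Rightarrow> 'v set \<Rightarrow> bool" where
  "C_k_on 0 f S \<longleftrightarrow> continuous_on S f"
| "C_k_on (Suc k) f S \<longleftrightarrow>
     (\<exists>f'. (\<forall>x\<in>S. (f has_derivative f' x) (at x)) \<and> (\<forall>v. C_k_on k (\<lambda>x. f' x v) S))"

definition smooth_on :: "'v set \<Rightarrow> ('v::real_normed_vector \<Rightarrow> 'w::real_normed_vector) \<Rightarrow> bool" where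
  "smooth_on S f \<longleftrightarrow> (\<forall>k. C_k_on k f S)"

text \<open>The topological space underlying the group is the type \<open>'g\<close>; \<open>'a\<close> is the model space of the
  charts and also the space of linear coordinates for the Lie algebra (both have dimension
  \<open>DIM('a)\<close>). A chart \<open>(U, c)\<close> is a map \<open>c\<close> of which only the restriction to \<open>U\<close> matters.
  \<open>lvf X\<close> is the left-invariant vector field with coordinate vector \<open>X\<close>, and \<open>layer i\<close>
  is \<open>\<gg>\<^sub>i\<close> in these coordinates (\<open>layer 0\<close> is not used).\<close>

record ('g, 'a) stratified_lie_group =
  mul :: "'g \<Rightarrow> 'g \<Rightarrow> 'g"
  one :: 'g
  inver :: "'g \<Rightarrow> 'g"
  charts :: "('g set \<times> ('g \<Rightarrow> 'a)) set"
  lvf :: "'a \<Rightarrow> ('g \<Rightarrow> real) \<Rightarrow> ('g \<Rightarrow> real)"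
  layer :: "nat \<Rightarrow> 'a set"

definition smooth_atlas ::
  "('g::topological_space set \<times> ('g \<Rightarrow> 'a::euclidean_space)) set \<Rightarrow> bool" where
  "smooth_atlas A \<longleftrightarrow>
     (\<Union>(U, c)\<in>A. U) = UNIV \<and>
     (\<forall>(U, c)\<in>A. open U \<and> open (c ` U) \<and> homeomorphism U (c ` U) c (inv_into U c)) \<and>
     (\<forall>(U, c)\<in>A. \<forall>(V, d)\<in>A. smooth_on (c ` (U \<inter> V)) (d \<circ> inv_into U c))"

definition lie_group ::
  "('g::{t2_space,second_countable_topology}, 'a::euclidean_space, 'm) stratified_lie_group_scheme
     \<Rightarrow> bool" where
  "lie_group G \<longleftrightarrow>
     group (mul G) (one G) (inver G) \<and>
     smooth_atlas (charts G) \<and>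
     continuous_on UNIV (\<lambda>(x, y). mul G x y) \<and>
     (\<forall>(U, c)\<in>charts G. \<forall>(V, d)\<in>charts G. \<forall>(W, e)\<in>charts G.
        smooth_on {(p, q). p \<in> c ` U \<and> q \<in> d ` V \<and> mul G (inv_into U c p) (inv_into V d q) \<in> W}
          (\<lambda>(p, q). e (mul G (inv_into U c p) (inv_into V d q)))) \<and>
     continuous_on UNIV (inver G) \<and>
     (\<forall>(U, c)\<in>charts G. \<forall>(V, d)\<in>charts G.
        smooth_on {p. p \<in> c ` U \<and> inver G (inv_into U c p) \<in> V}
          (\<lambda>p. d (inver G (inv_into U c p))))"

section \<open>Left-invariant vector fields\<close>

definition smooth_functions ::
  "('g, 'a::euclidean_space, 'm) stratified_lie_group_scheme \<Rightarrow> ('g \<Rightarrow> real) set" where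
  "smooth_functions G = {f. \<forall>(U, c)\<in>charts G. smooth_on (c ` U) (f \<circ> inv_into U c)}"

text \<open>Smooth vector fields are derivations of the algebra of smooth functions. As HOL functions are
  total, a derivation is set to zero on non-smooth functions, so that it is determined by its action
  on smooth ones.\<close>

definition vector_fields ::
  "('g, 'a::euclidean_space, 'm) stratified_lie_group_scheme
     \<Rightarrow> (('g \<Rightarrow> real) \<Rightarrow> ('g \<Rightarrow> real)) set" where
  "vector_fields G =
     {D. (\<forall>f. f \<notin> smooth_functions G \<longrightarrow> D f = (\<lambda>_. 0)) \<and>
         (\<forall>f\<in>smooth_functions G. D f \<in> smooth_functions G) \<and>
         (\<forall>f\<in>smooth_functions G. \<forall>h\<in>smooth_functions G.
            (\<forall>a b. D (\<lambda>x. a * f x + b * h x) = (\<lambda>x. a * D f x + b * D h x)) \<and>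
            D (\<lambda>x. f x * h x) = (\<lambda>x. f x * D h x + D f x * h x))}"

definition left_invariant_fields ::
  "('g, 'a::euclidean_space, 'm) stratified_lie_group_scheme
     \<Rightarrow> (('g \<Rightarrow> real) \<Rightarrow> ('g \<Rightarrow> real)) set" where
  "left_invariant_fields G =
     {D \<in> vector_fields G.
        \<forall>f\<in>smooth_functions G. \<forall>g. D (\<lambda>x. f (mul G g x)) = (\<lambda>x. D f (mul G g x))}"

definition commutator ::
  "(('g \<Rightarrow> real) \<Rightarrow> ('g \<Rightarrow> real)) \<Rightarrow> (('g \<Rightarrow> real) \<Rightarrow> ('g \<Rightarrow> real)) \<Rightarrow> ('g \<Rightarrow> real) \<Rightarrow> ('g \<Rightarrow> real)"
  where "commutator D E f = (\<lambda>x. D (E f) x - E (D f) x)"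

text \<open>\<open>lvf G\<close> is a linear isomorphism from \<open>'a\<close> onto the Lie algebra. Choosing it amounts to choosing
  a basis of the Lie algebra, equivalently a scalar product with an orthonormal basis. The scalar
  product of \<open>'a\<close>, restricted to \<open>layer G 1\<close>, is the scalar product fixed on \<open>\<gg>\<^sub>1\<close>, and every
  scalar product on \<open>\<gg>\<^sub>1\<close> arises from some such isomorphism.\<close>

definition lie_algebra_coordinates ::
  "('g, 'a::euclidean_space, 'm) stratified_lie_group_scheme \<Rightarrow> bool" where
  "lie_algebra_coordinates G \<longleftrightarrow>
     bij_betw (lvf G) UNIV (left_invariant_fields G) \<and>
     (\<forall>a b X Y f. lvf G (a *\<^sub>R X + b *\<^sub>R Y) f = (\<lambda>p. a * lvf G X f p + b * lvf G Y f p))"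

section \<open>Carnot groups\<close>

definition bracket_span ::
  "('g, 'a::euclidean_space, 'm) stratified_lie_group_scheme \<Rightarrow> 'a set \<Rightarrow> 'a set \<Rightarrow> 'a set" where
  "bracket_span G V W =
     span {Z. \<exists>X\<in>V. \<exists>Y\<in>W. lvf G Z = commutator (lvf G X) (lvf G Y)}"

definition stratification ::
  "('g, 'a::euclidean_space, 'm) stratified_lie_group_scheme \<Rightarrow> nat \<Rightarrow> bool" where
  "stratification G s \<longleftrightarrow>
     s \<ge> 1 \<and>
     (\<forall>i\<ge>1. subspace (layer G i)) \<and>
     (\<forall>X. \<exists>!v. (\<forall>i\<in>{1..s}. v i \<in> layer G i) \<and> (\<forall>i. i \<notin> {1..s} \<longrightarrow> v i = 0) \<and>
               X = (\<Sum>i\<in>{1..s}. v i)) \<and>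
     (\<forall>i\<in>{1..s}. bracket_span G (layer G 1) (layer G i) = layer G (Suc i)) \<and>
     layer G s \<noteq> {0} \<and>
     (\<forall>i>s. layer G i = {0})"

definition carnot_group ::
  "('g::{t2_space,second_countable_topology}, 'a::euclidean_space, 'm) stratified_lie_group_scheme
     \<Rightarrow> bool" where
  "carnot_group G \<longleftrightarrow>
     lie_group G \<and>
     connected (UNIV :: 'g set) \<and> simply_connected (UNIV :: 'g set) \<and>
     lie_algebra_coordinates G \<and>
     (\<exists>s. stratification G s)"

text \<open>The exponential map is the unique \<open>ex\<close> such that, for every \<open>X\<close>, the map \<open>t \<mapsto> ex (tX)\<close> is the
  one-parameter subgroup with initial velocity \<open>X\<close>. By left invariance, the integral curve of \<open>X\<close>
  starting at \<open>x\<close> is then \<open>t \<mapsto> x \<cdot> ex (tX)\<close>.\<close>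

definition exponential_map ::
  "('g::topological_space, 'a::euclidean_space, 'm) stratified_lie_group_scheme
     \<Rightarrow> ('a \<Rightarrow> 'g) \<Rightarrow> bool" where
  "exponential_map G ex \<longleftrightarrow>
     (\<forall>X. continuous_on UNIV (\<lambda>t::real. ex (t *\<^sub>R X)) \<and>
          (\<forall>s t. ex ((s + t) *\<^sub>R X) = mul G (ex (s *\<^sub>R X)) (ex (t *\<^sub>R X))) \<and>
          (\<forall>f\<in>smooth_functions G.
             ((\<lambda>t. f (ex (t *\<^sub>R X))) has_real_derivative lvf G X f (one G)) (at 0)))"

text \<open>Haar measure of a closed subgroup \<open>H\<close> of \<open>G\<close>, as a measure on the Borel sets of \<open>H\<close>. The groups
  in question are locally compact and second countable, so regularity is automatic.\<close>

definition haar_measure_on ::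
  "('g::topological_space, 'a, 'm) stratified_lie_group_scheme \<Rightarrow> 'g set \<Rightarrow> 'g measure \<Rightarrow> bool" where
  "haar_measure_on G H \<mu> \<longleftrightarrow>
     sets \<mu> = sets (restrict_space borel H) \<and>
     (\<forall>x\<in>H. \<forall>B\<in>sets \<mu>. emeasure \<mu> (mul G x ` B) = emeasure \<mu> B) \<and>
     (\<forall>K. compact K \<and> K \<subseteq> H \<longrightarrow> emeasure \<mu> K < \<infinity>) \<and>
     emeasure \<mu> H \<noteq> 0"

section \<open>The space of lines\<close>

text \<open>The standard measure on the unit sphere of a subspace \<open>V\<close> of dimension \<open>d\<close> is obtained from
  Lebesgue measure on \<open>V\<close> by $\sigma(A) = d \, \lambda_V \{r X : X \in A,\ 0 < r \le 1\}$. The choice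
  of orthonormal basis does not affect $\lambda_V$.\<close>

definition subspace_lebesgue :: "'a::euclidean_space set \<Rightarrow> 'a measure" where
  "subspace_lebesgue V =
     (let B = (SOME B. B \<subseteq> V \<and> pairwise orthogonal B \<and> (\<forall>b\<in>B. norm b = 1) \<and>
                       independent B \<and> span B = V)
      in distr (PiM B (\<lambda>_. lborel :: real measure)) borel (\<lambda>u. \<Sum>b\<in>B. u b *\<^sub>R b))"

definition unit_sphere :: "'a::euclidean_space set \<Rightarrow> 'a set" where
  "unit_sphere V = {X \<in> V. norm X = 1}"

definition sphere_measure :: "'a::euclidean_space set \<Rightarrow> 'a measure" where
  "sphere_measure V =
     scale_measure (of_nat (dim V))
       (distr (restrict_space (subspace_lebesgue V) (V \<inter> cball 0 1 - {0}))
          (restrict_space borel (unit_sphere V)) sgn)"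

definition perp ::
  "('g, 'a::euclidean_space, 'm) stratified_lie_group_scheme \<Rightarrow> 'a \<Rightarrow> 'a set" where
  "perp G X = {Y + Z | Y Z. Y \<in> layer G 1 \<and> X \<bullet> Y = 0 \<and> Z \<in> span (\<Union>i\<in>{2..}. layer G i)}"

definition N_sub ::
  "('g, 'a::euclidean_space, 'm) stratified_lie_group_scheme \<Rightarrow> ('a \<Rightarrow> 'g) \<Rightarrow> 'a \<Rightarrow> 'g set" where
  "N_sub G ex X = ex ` perp G X"

definition normalized_haar_on_N ::
  "('g::topological_space, 'a::euclidean_space, 'm) stratified_lie_group_scheme \<Rightarrow> ('a \<Rightarrow> 'g)
     \<Rightarrow> 'g measure \<Rightarrow> 'a \<Rightarrow> 'g measure \<Rightarrow> bool" where
  "normalized_haar_on_N G ex \<mu> X \<nu> \<longleftrightarrow>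
     haar_measure_on G (N_sub G ex X) \<nu> \<and>
     (\<lambda>(x, t). mul G x (ex (t *\<^sub>R X))) \<in> (\<nu> \<Otimes>\<^sub>M lborel) \<rightarrow>\<^sub>M \<mu> \<and>
     distr (\<nu> \<Otimes>\<^sub>M lborel) \<mu> (\<lambda>(x, t). mul G x (ex (t *\<^sub>R X))) = \<mu>"

text \<open>An oriented line is the image of an integral curve together with its orientation, given by
  the ray of all positive multiples of \<open>X\<close>.\<close>

definition oriented_line ::
  "('g, 'a::euclidean_space, 'm) stratified_lie_group_scheme \<Rightarrow> ('a \<Rightarrow> 'g) \<Rightarrow> 'a \<Rightarrow> 'g
     \<Rightarrow> 'g set \<times> 'a set" where
  "oriented_line G ex X x =
     (range (\<lambda>t::real. mul G x (ex (t *\<^sub>R X))), {c *\<^sub>R X | c. c > 0})"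

definition lines ::
  "('g, 'a::euclidean_space, 'm) stratified_lie_group_scheme \<Rightarrow> ('a \<Rightarrow> 'g)
     \<Rightarrow> ('g set \<times> 'a set) set" where
  "lines G ex = {oriented_line G ex X x | X x. X \<in> layer G 1 - {0}}"

text \<open>The measure on the set of lines is the outer measure extending
  $A \mapsto \int \mu_X\{x \in N_X : (X,x) \in A\}\,d\sigma(X)$ from Borel sets. The family
  $(\mu_X)$ is uniquely determined by the normalization and the integrand is always measurable;
  measurability is stated explicitly because \<open>nn_integral\<close> is a lower integral on non-measurable
  functions.\<close>

definition null_set_of_lines ::
  "('g::topological_space, 'a::euclidean_space, 'm) stratified_lie_group_scheme \<Rightarrow> ('a \<Rightarrow> 'g)
     \<Rightarrow> 'g measure \<Rightarrow> ('g set \<times> 'a set) set \<Rightarrow> bool" where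
  "null_set_of_lines G ex \<mu> \<L> \<longleftrightarrow>
     (\<exists>\<nu>. (\<forall>X\<in>unit_sphere (layer G 1). normalized_haar_on_N G ex \<mu> X (\<nu> X)) \<and>
        (\<exists>A \<in> sets (borel :: ('a \<times> 'g) measure).
           {(X, x). X \<in> unit_sphere (layer G 1) \<and> x \<in> N_sub G ex X \<and>
                    oriented_line G ex X x \<in> \<L>} \<subseteq> A \<and>
           (\<lambda>X. emeasure (\<nu> X) {x \<in> N_sub G ex X. (X, x) \<in> A})
             \<in> borel_measurable (sphere_measure (layer G 1)) \<and>
           (\<integral>\<^sup>+X. emeasure (\<nu> X) {x \<in> N_sub G ex X. (X, x) \<in> A} \<partial>sphere_measure (layer G 1)) = 0))"

section \<open>Monotone sets and sets of locally finite perimeter\<close>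

definition monotone_line ::
  "('g, 'a::euclidean_space, 'm) stratified_lie_group_scheme \<Rightarrow> ('a \<Rightarrow> 'g) \<Rightarrow> 'g set
     \<Rightarrow> 'g set \<times> 'a set \<Rightarrow> bool" where
  "monotone_line G ex E L \<longleftrightarrow>
     (\<exists>X x h. X \<in> layer G 1 - {0} \<and> L = oriented_line G ex X x \<and>
        (mono h \<or> antimono h) \<and>
        (AE t in lborel. (indicator E (mul G x (ex (t *\<^sub>R X))) :: real) = h t))"

definition monotone_set ::
  "('g::topological_space, 'a::euclidean_space, 'm) stratified_lie_group_scheme \<Rightarrow> ('a \<Rightarrow> 'g)
     \<Rightarrow> 'g measure \<Rightarrow> 'g set \<Rightarrow> bool" where
  "monotone_set G ex \<mu> E \<longleftrightarrow>
     E \<in> sets (completion \<mu>) \<and>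
     null_set_of_lines G ex \<mu> {L \<in> lines G ex. \<not> monotone_line G ex E L}"

definition test_functions ::
  "('g::topological_space, 'a::euclidean_space, 'm) stratified_lie_group_scheme
     \<Rightarrow> ('g \<Rightarrow> real) set" where
  "test_functions G = {\<phi> \<in> smooth_functions G. compact (closure {x. \<phi> x \<noteq> 0})}"

text \<open>On a locally compact second countable space every locally finite Borel measure is regular.\<close>

definition radon_measure :: "'g::topological_space measure \<Rightarrow> bool" where
  "radon_measure \<nu> \<longleftrightarrow> sets \<nu> = sets borel \<and> (\<forall>K. compact K \<longrightarrow> emeasure \<nu> K < \<infinity>)"

text \<open>A signed Radon measure is a difference of two Radon measures. Both may have infinite total
  mass, so it is represented as such a pair, acting on compactly supported continuous functions.\<close>

definition locally_finite_perimeter ::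
  "('g::topological_space, 'a::euclidean_space, 'm) stratified_lie_group_scheme
     \<Rightarrow> 'g measure \<Rightarrow> 'g set \<Rightarrow> bool" where
  "locally_finite_perimeter G \<mu> E \<longleftrightarrow>
     E \<in> sets (completion \<mu>) \<and>
     (\<forall>X\<in>layer G 1. \<exists>\<nu>1 \<nu>2. radon_measure \<nu>1 \<and> radon_measure \<nu>2 \<and>
        (\<forall>\<phi>\<in>test_functions G.
           - (LINT x:E|completion \<mu>. lvf G X \<phi> x) = (LINT x|\<nu>1. \<phi> x) - (LINT x|\<nu>2. \<phi> x)))"

end

theory Submission
  imports Defs
begin

text \<open>
  Fix a unit vector \<open>X\<close> of the first layer such that almost every line in direction \<open>X\<close> is
  monotone; by Fubini almost every \<open>X\<close> is of this kind. On almost every such line \<open>E\<close> is, up to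
  null sets, empty, everything, or a half-line, so integrating \<open>X\<phi>\<close> over it leaves only the value
  of \<open>\<plusminus>\<phi>\<close> at the endpoint. Hence \<open>X 1\<^sub>E\<close> is the difference of the two images of \<open>\<mu>\<^sub>X\<close> under the maps
  sending a line to its upward, respectively downward, jump. These are finite on a compact set \<open>K\<close>:
  a line meeting \<open>K\<close> spends at least unit time in the compact set \<open>K \<cdot> exp([0,1]X)\<close>, so by Fubini
  the lines meeting \<open>K\<close> have measure at most \<open>\<mu> (K \<cdot> exp([0,1]X))\<close>. Finally, a subset of full measure
  of the sphere spans the first layer, and \<open>X \<mapsto> X 1\<^sub>E\<close> is linear.
\<close>

section \<open>Smooth functions on Lie groups\<close>

text \<open>The normalization of \<open>\<mu>\<^sub>X\<close> makes \<mu> the image of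
  \<open>\<mu>\<^sub>X \<otimes> dt\<close> under \<open>(x, t) \<mapsto> x \<cdot> exp(tX)\<close>,
  so integration by parts can be done on each line separately, provided test functions vanish far
  out on the line. The estimate by time spent in \<open>K \<cdot> exp([0,1]X)\<close> supplies this
  too, and it also yields sigma-finiteness of \<open>\<mu>\<^sub>X\<close>, on which Fubini depends.
  The other obstacle is measurability: E is measurable only for the completion of \<mu>, and the
  endpoint of a half-line must depend measurably on the line. So E is exchanged for a Borel set
  differing from it by a null set, and the endpoint is read off from lengths: for the half-line from
  s to infinity, the positive and negative parts of s are the length it misses in the positive axis
  and the length it covers in the negative axis. No particular direction is known to be good, which
  is why linear algebra enters at the end: a proper subspace of the first layer meets the sphere in
  a null set.\<close>

lemma C_k_on_cong:
  assumes "open S" "C_k_on k f S" "\<And>x. x \<in> S \<Longrightarrow> f x = g x"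
  shows "C_k_on k g S"
proof (cases k)
  case 0
  with assms show ?thesis by (auto cong: continuous_on_cong)
next
  case (Suc j)
  with assms obtain f' where
    f': "\<forall>x\<in>S. (f has_derivative f' x) (at x)" "\<forall>v. C_k_on j (\<lambda>x. f' x v) S"
    by auto
  have "(g has_derivative f' x) (at x)" if "x \<in> S" for x
    using f'(1) that assms(1,3) by (blast intro: has_derivative_transform_within_open)
  with f'(2) Suc show ?thesis by auto
qed

lemma C_k_on_Suc_imp: "C_k_on (Suc k) f S \<Longrightarrow> C_k_on k f S"
proof (induction k arbitrary: f)
  case 0
  then obtain f' where "\<forall>x\<in>S. (f has_derivative f' x) (at x)" by auto
  then show ?case
    by (auto intro!: continuous_at_imp_continuous_on has_derivative_continuous)
next
  case (Suc k)
  from Suc.prems obtain f' where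
    f': "\<forall>x\<in>S. (f has_derivative f' x) (at x)" "\<forall>v. C_k_on (Suc k) (\<lambda>x. f' x v) S"
    unfolding C_k_on.simps(2)[of "Suc k"] by blast
  then have "\<forall>v. C_k_on k (\<lambda>x. f' x v) S" using Suc.IH by blast
  with f' show ?case by auto
qed

lemma C_k_on_const: "C_k_on k (\<lambda>x. c) S"
proof (induction k arbitrary: c)
  case (Suc k)
  show ?case unfolding C_k_on.simps
    by (rule exI[of _ "\<lambda>x v. 0"]) (auto intro: Suc)
qed auto

lemma C_k_on_add: "C_k_on k f S \<Longrightarrow> C_k_on k g S \<Longrightarrow> C_k_on k (\<lambda>x. f x + g x) S"
proof (induction k arbitrary: f g)
  case 0
  then show ?case by (auto intro: continuous_on_add)
next
  case (Suc k)
  then obtain f' g' where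
    "\<forall>x\<in>S. (f has_derivative f' x) (at x)" "\<forall>v. C_k_on k (\<lambda>x. f' x v) S"
    "\<forall>x\<in>S. (g has_derivative g' x) (at x)" "\<forall>v. C_k_on k (\<lambda>x. g' x v) S"
    by auto
  with Suc.IH show ?case unfolding C_k_on.simps
    by (intro exI[of _ "\<lambda>x v. f' x v + g' x v"]) (auto intro: has_derivative_add)
qed

lemma C_k_on_sum: "(\<And>i. i \<in> I \<Longrightarrow> C_k_on k (f i) S) \<Longrightarrow> C_k_on k (\<lambda>x. \<Sum>i\<in>I. f i x) S"
  by (induction I rule: infinite_finite_induct) (auto intro: C_k_on_const C_k_on_add)

lemma C_k_on_scaleR:
  "C_k_on k f S \<Longrightarrow> C_k_on k g S \<Longrightarrow> C_k_on k (\<lambda>x. f x *\<^sub>R g x) S"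
proof (induction k arbitrary: f g)
  case 0
  then show ?case by (auto intro: continuous_on_scaleR)
next
  case (Suc k)
  then obtain f' g' where
    *: "\<forall>x\<in>S. (f has_derivative f' x) (at x)" "\<forall>v. C_k_on k (\<lambda>x. f' x v) S"
    "\<forall>x\<in>S. (g has_derivative g' x) (at x)" "\<forall>v. C_k_on k (\<lambda>x. g' x v) S"
    by auto
  have "C_k_on k f S" "C_k_on k g S" using Suc.prems C_k_on_Suc_imp by blast+
  then have "C_k_on k (\<lambda>x. f x *\<^sub>R g' x v + f' x v *\<^sub>R g x) S" for v
    using * Suc.IH by (auto intro: C_k_on_add)
  with * show ?case unfolding C_k_on.simps
    by (intro exI[of _ "\<lambda>x v. f x *\<^sub>R g' x v + f' x v *\<^sub>R g x"]) (auto intro: has_derivative_scaleR)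
qed

lemma C_k_on_bounded_linear:
  assumes "bounded_linear L" shows "C_k_on k f S \<Longrightarrow> C_k_on k (\<lambda>x. L (f x)) S"
proof (induction k arbitrary: f)
  case 0
  then show ?case using assms by (auto intro: bounded_linear.continuous_on)
next
  case (Suc k)
  then obtain f' where
    "\<forall>x\<in>S. (f has_derivative f' x) (at x)" "\<forall>v. C_k_on k (\<lambda>x. f' x v) S"
    by auto
  with Suc.IH assms show ?case unfolding C_k_on.simps
    by (intro exI[of _ "\<lambda>x v. L (f' x v)"]) (auto intro: bounded_linear.has_derivative)
qed

lemma C_k_on_Pair: "C_k_on k (\<lambda>q. (p, q)) S"
proof (cases k)
  case (Suc j)
  show ?thesis unfolding Suc C_k_on.simps
    by (rule exI[of _ "\<lambda>x v. (0, v)"])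
       (auto intro!: C_k_on_const has_derivative_Pair has_derivative_const has_derivative_ident)
qed (auto intro!: continuous_intros)

text \<open>The induction hypothesis speaks of \<open>y \<mapsto> g' y b\<close> for a fixed
  direction \<open>b\<close>, whereas the chain rule produces \<open>g' (f x) (f' x v)\<close>,
  whose direction varies with \<open>x\<close>. Expanding \<open>f' x v\<close> in the basis of the
  middle space reduces the latter to finitely many fixed directions.\<close>

lemma C_k_on_compose:
  fixes f :: "'u::real_normed_vector \<Rightarrow> 'v::euclidean_space"
    and g :: "'v \<Rightarrow> 'w::real_normed_vector"
  assumes "open S" "f ` S \<subseteq> T"
  shows "C_k_on k g T \<Longrightarrow> C_k_on k f S \<Longrightarrow> C_k_on k (\<lambda>x. g (f x)) S"
proof (induction k arbitrary: g)
  case 0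
  then show ?case using assms continuous_on_compose2 by fastforce
next
  case (Suc k)
  then obtain f' g' where
    *: "\<forall>x\<in>S. (f has_derivative f' x) (at x)" "\<forall>v. C_k_on k (\<lambda>x. f' x v) S"
    "\<forall>x\<in>T. (g has_derivative g' x) (at x)" "\<forall>v. C_k_on k (\<lambda>x. g' x v) T"
    by auto
  have fk: "C_k_on k f S" using Suc.prems C_k_on_Suc_imp by blast
  have 1: "((\<lambda>x. g (f x)) has_derivative (\<lambda>v. g' (f x) (f' x v))) (at x)" if "x \<in> S" for x
    using * assms(2) that by (auto intro!: has_derivative_compose[of f "f' x" x UNIV g "g' (f x)"])
  have 2: "C_k_on k (\<lambda>x. g' (f x) (f' x v)) S" for v
  proof (rule C_k_on_cong[OF assms(1)])
    show "C_k_on k (\<lambda>x. \<Sum>b\<in>Basis. (f' x v \<bullet> b) *\<^sub>R g' (f x) b) S"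
      using * by (intro C_k_on_sum C_k_on_scaleR C_k_on_bounded_linear[OF bounded_linear_inner_left]
            Suc.IH[OF _ fk, of "\<lambda>y. g' y b" for b]) auto
    fix x assume "x \<in> S"
    then have "linear (g' (f x))"
      using * assms(2) has_derivative_linear by blast
    then show "(\<Sum>b\<in>Basis. (f' x v \<bullet> b) *\<^sub>R g' (f x) b) = g' (f x) (f' x v)"
      by (subst (2) euclidean_representation[symmetric]) (simp add: linear_sum linear_cmul)
  qed
  show ?case unfolding C_k_on.simps
    using 1 2 by (intro exI[of _ "\<lambda>x v. g' (f x) (f' x v)"]) auto
qed

text \<open>The derivative is given on each neighbourhood by its own witness; by uniqueness of
  derivatives at interior points all of them agree with \<open>frechet_derivative\<close>, which
  therefore is one global witness.\<close>

lemma C_k_on_local: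
  "(\<And>x. x \<in> S \<Longrightarrow> \<exists>T. open T \<and> x \<in> T \<and> C_k_on k f T) \<Longrightarrow> C_k_on k f S"
proof (induction k arbitrary: f)
  case 0
  have "isCont f x" if "x \<in> S" for x
    using 0[OF that] by (auto simp: continuous_on_eq_continuous_at)
  then show ?case by (auto intro: continuous_at_imp_continuous_on)
next
  case (Suc k)
  define f' where "f' x = frechet_derivative f (at x)" for x
  have *: "\<exists>T. open T \<and> x \<in> T \<and> (\<forall>y\<in>T. (f has_derivative f' y) (at y)) \<and>
      (\<forall>v. C_k_on k (\<lambda>x. f' x v) T)" if xS: "x \<in> S" for x
  proof -
    obtain T h where T: "open T" "x \<in> T" "\<forall>y\<in>T. (f has_derivative h y) (at y)"
      "\<forall>v. C_k_on k (\<lambda>x. h x v) T"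
      using Suc.prems[OF xS] unfolding C_k_on.simps by blast
    have "h y = f' y" if "y \<in> T" for y
      unfolding f'_def using T(3) that frechet_derivative_at by blast
    with T show ?thesis by (intro exI[of _ T]) (auto intro: C_k_on_cong)
  qed
  have "C_k_on k (\<lambda>x. f' x v) S" for v
    using * by (intro Suc.IH) blast
  with * show ?case unfolding C_k_on.simps
    by (intro exI[of _ f']) blast
qed

section \<open>Charts, left translations and sigma-compactness\<close>

lemma smooth_atlas_chartD:
  assumes "smooth_atlas A" "(U, c) \<in> A"
  shows "open U" "open (c ` U)" "continuous_on U c" "continuous_on (c ` U) (inv_into U c)"
    "x \<in> U \<Longrightarrow> inv_into U c (c x) = x"
proof -
  have "open U \<and> open (c ` U) \<and> homeomorphism U (c ` U) c (inv_into U c)"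
    using assms unfolding smooth_atlas_def by blast
  then show "open U" "open (c ` U)" "continuous_on U c" "continuous_on (c ` U) (inv_into U c)"
    "x \<in> U \<Longrightarrow> inv_into U c (c x) = x"
    by (blast intro: homeomorphism_cont1 homeomorphism_cont2 homeomorphism_apply1)+
qed

lemma smooth_atlas_ex_chart:
  assumes "smooth_atlas A" shows "\<exists>U c. (U, c) \<in> A \<and> x \<in> U"
proof -
  have "(\<Union>(U, c)\<in>A. U) = UNIV" using assms by (simp add: smooth_atlas_def)
  then have "x \<in> (\<Union>(U, c)\<in>A. U)" by (simp only: UNIV_I)
  then show ?thesis by auto
qed

lemma smooth_functions_continuous:
  fixes f :: "'g::topological_space \<Rightarrow> real"
  assumes "smooth_atlas (charts G)" "f \<in> smooth_functions G"
  shows "continuous_on UNIV f"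
proof -
  have "continuous_on U f" "open U" if "(U, c) \<in> charts G" for U c
  proof -
    note chart = smooth_atlas_chartD[OF assms(1) that]
    have "smooth_on (c ` U) (f \<circ> inv_into U c)"
      using assms(2) that by (auto simp: smooth_functions_def)
    then have "continuous_on (c ` U) (f \<circ> inv_into U c)"
      unfolding smooth_on_def by (metis C_k_on.simps(1))
    then have "continuous_on U (\<lambda>x. (f \<circ> inv_into U c) (c x))"
      by (rule continuous_on_compose2[OF _ chart(3)]) simp
    then show "continuous_on U f"
      by (rule continuous_on_eq) (simp add: chart(5))
    show "open U" by (fact chart(1))
  qed
  then have "continuous_on (\<Union>U\<in>fst ` charts G. U) f"
    by (intro continuous_on_open_UN) auto
  moreover have "(\<Union>U\<in>fst ` charts G. U) = UNIV"
    using smooth_atlas_ex_chart[OF assms(1)] by (force simp: image_iff Bex_def)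
  ultimately show ?thesis by simp
qed

text \<open>In charts around \<open>g\<close> and around the point, left translation by
  \<open>g\<close> is the group multiplication with its first coordinate frozen at
  \<open>d g\<close>. The chart \<open>W\<close> for the product depends on the point, so smoothness
  is checked locally. The lemma allows derivatives at the identity to be moved to arbitrary
  points.\<close>

lemma smooth_functions_left_translate:
  fixes G :: "('g::{t2_space,second_countable_topology}, 'a::euclidean_space, 'm) stratified_lie_group_scheme"
  assumes "lie_group G" "f \<in> smooth_functions G"
  shows "(\<lambda>x. f (mul G g x)) \<in> smooth_functions G"
  unfolding smooth_functions_def smooth_on_def
proof (safe)
  fix U c k assume Uc: "(U, c) \<in> charts G"
  have atl: "smooth_atlas (charts G)" and mulc: "continuous_on UNIV (\<lambda>(x, y). mul G x y)"
    using assms(1) by (auto simp: lie_group_def)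
  note chart = smooth_atlas_chartD[OF atl] and ex_chart = smooth_atlas_ex_chart[OF atl]
  note inv_c = chart(5)
  obtain V d where Vd: "(V, d) \<in> charts G" "g \<in> V" using ex_chart by blast
  show "C_k_on k ((\<lambda>x. f (mul G g x)) \<circ> inv_into U c) (c ` U)"
  proof (rule C_k_on_local)
    fix q0 assume q0: "q0 \<in> c ` U"
    obtain W e where We: "(W, e) \<in> charts G" "mul G g (inv_into U c q0) \<in> W" using ex_chart by blast
    define T where "T = {q \<in> c ` U. mul G g (inv_into U c q) \<in> W}"
    define P where "P = {(p, q). p \<in> d ` V \<and> q \<in> c ` U \<and> mul G (inv_into V d p) (inv_into U c q) \<in> W}"
    have "continuous_on (c ` U) (\<lambda>q. (\<lambda>(x, y). mul G x y) (g, inv_into U c q))"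
      by (intro continuous_on_compose2[OF mulc] continuous_on_Pair continuous_on_const chart(4)[OF Uc]) simp
    then have "open (c ` U \<inter> (\<lambda>q. mul G g (inv_into U c q)) -` W)"
      using continuous_open_preimage[OF _ chart(2)[OF Uc] chart(1)[OF We(1)]] by simp
    moreover have "T = c ` U \<inter> (\<lambda>q. mul G g (inv_into U c q)) -` W"
      by (auto simp: T_def)
    ultimately have "open T" by simp
    have "smooth_on P (\<lambda>(p, q). e (mul G (inv_into V d p) (inv_into U c q)))"
      using assms(1) Uc Vd(1) We(1) unfolding lie_group_def P_def by blast
    then have "C_k_on k (\<lambda>(p, q). e (mul G (inv_into V d p) (inv_into U c q))) P"
      by (simp add: smooth_on_def)
    then have "C_k_on k (\<lambda>q. (\<lambda>(p, q). e (mul G (inv_into V d p) (inv_into U c q))) (d g, q)) T"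
      by (rule C_k_on_compose[OF \<open>open T\<close>, rotated]) (use Vd inv_c in \<open>auto simp: T_def P_def C_k_on_Pair\<close>)
    then have 1: "C_k_on k (\<lambda>q. e (mul G g (inv_into U c q))) T"
      using Vd by (simp add: inv_c)
    have "C_k_on k (f \<circ> inv_into W e) (e ` W)"
      using assms(2) We(1) by (auto simp: smooth_functions_def smooth_on_def)
    then have "C_k_on k (\<lambda>q. (f \<circ> inv_into W e) (e (mul G g (inv_into U c q)))) T"
      by (rule C_k_on_compose[OF \<open>open T\<close>, rotated]) (use 1 in \<open>auto simp: T_def\<close>)
    then have "C_k_on k ((\<lambda>x. f (mul G g x)) \<circ> inv_into U c) T"
      by (rule C_k_on_cong[OF \<open>open T\<close>]) (use We(1) in \<open>auto simp: T_def inv_c\<close>)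
    then show "\<exists>T. open T \<and> q0 \<in> T \<and> C_k_on k ((\<lambda>x. f (mul G g x)) \<circ> inv_into U c) T"
      using \<open>open T\<close> q0 We(2) by (intro exI[of _ T]) (auto simp: T_def)
  qed
qed

text \<open>Preimages of small balls under charts are open and lie in compact sets; second
  countability leaves countably many of them.\<close>

lemma sigma_compact_manifold:
  fixes G :: "('g::{t2_space,second_countable_topology}, 'a::euclidean_space, 'm) stratified_lie_group_scheme"
  assumes "smooth_atlas (charts G)"
  shows "\<exists>K :: nat \<Rightarrow> 'g set. (\<forall>n. compact (K n)) \<and> (\<Union>n. K n) = UNIV"
proof -
  define \<F> where "\<F> = {W :: 'g set. open W \<and> (\<exists>C. compact C \<and> W \<subseteq> C)}"
  have "\<exists>W\<in>\<F>. x \<in> W" for x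
  proof -
    obtain U c where Uc: "(U, c) \<in> charts G" "x \<in> U"
      using smooth_atlas_ex_chart[OF assms] by blast
    note chart = smooth_atlas_chartD[OF assms Uc(1)]
    obtain r where r: "r > 0" "cball (c x) r \<subseteq> c ` U"
      using chart(2) Uc(2) open_contains_cball by (metis imageI)
    define W where "W = U \<inter> c -` ball (c x) r"
    have "open W" unfolding W_def
      by (rule continuous_open_preimage[OF chart(3,1)]) simp
    moreover have "compact (inv_into U c ` cball (c x) r)"
      by (rule compact_continuous_image[OF continuous_on_subset[OF chart(4) r(2)] compact_cball])
    moreover have "W \<subseteq> inv_into U c ` cball (c x) r"
    proof
      fix y assume y: "y \<in> W"
      then have "inv_into U c (c y) = y" using chart(5) by (simp add: W_def)
      then show "y \<in> inv_into U c ` cball (c x) r"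
        using y by (intro image_eqI[of _ _ "c y"]) (auto simp: W_def)
    qed
    ultimately have "W \<in> \<F>" unfolding \<F>_def by blast
    then show ?thesis using Uc(2) r(1) by (intro bexI[of _ W]) (auto simp: W_def)
  qed
  then have "\<Union>\<F> = UNIV" by blast
  moreover have "\<And>W. W \<in> \<F> \<Longrightarrow> open W" by (auto simp: \<F>_def)
  ultimately obtain \<F>' where \<F>': "\<F>' \<subseteq> \<F>" "countable \<F>'" "\<Union>\<F>' = UNIV"
    using Lindelof[of \<F>] by metis
  obtain C where C: "\<And>W. W \<in> \<F> \<Longrightarrow> compact (C W) \<and> W \<subseteq> C W"
  proof -
    have "\<forall>W\<in>\<F>. \<exists>C. compact C \<and> W \<subseteq> C" by (auto simp: \<F>_def)
    from bchoice[OF this] show ?thesis using that by blast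
  qed
  have "\<F>' \<noteq> {}" using \<F>'(3) by auto
  show ?thesis
  proof (intro exI[of _ "\<lambda>n. C (from_nat_into \<F>' n)"] conjI allI)
    show "compact (C (from_nat_into \<F>' n))" for n
      using C[of "from_nat_into \<F>' n"] subsetD[OF \<F>'(1) from_nat_into[OF \<open>\<F>' \<noteq> {}\<close>]] by simp
    show "(\<Union>n. C (from_nat_into \<F>' n)) = UNIV"
    proof (rule UNIV_eq_I[symmetric])
      fix x
      obtain W where W: "W \<in> \<F>'" "x \<in> W" using \<F>'(3) UNIV_I[of x] by (metis UnionE)
      obtain n where n: "from_nat_into \<F>' n = W" using from_nat_into_surj[OF \<F>'(2) W(1)] by blast
      have "x \<in> C W" using C[of W] W \<F>'(1) by blast
      then have "x \<in> C (from_nat_into \<F>' n)" by (simp add: n)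
      then show "x \<in> (\<Union>n. C (from_nat_into \<F>' n))" by (rule UN_I[OF UNIV_I])
    qed
  qed
qed

section \<open>Monotone subsets of the line\<close>

lemma AE_indicator_mono_cases:
  fixes h :: "real \<Rightarrow> real"
  assumes "mono h" "AE t in lborel. (indicator A t :: real) = h t"
  shows "(AE t in lborel. t \<notin> A) \<or> (AE t in lborel. t \<in> A) \<or> (\<exists>s. AE t in lborel. t \<in> A \<longleftrightarrow> s \<le> t)"
proof -
  \<comment> \<open>Almost everywhere \<open>h\<close> takes only the values 0 and 1, so any
    threshold in \<open>(0, 1]\<close> would single out \<open>A\<close> up to a null set.
    Monotonicity of \<open>h\<close> makes \<open>B\<close> upward closed everywhere.\<close>
  define B where "B = {t. h t \<ge> 1}"
  have AB: "AE t in lborel. t \<in> A \<longleftrightarrow> t \<in> B"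
    using assms(2) by eventually_elim (auto simp: B_def split: split_indicator_asm)
  have up: "t \<in> B" if "s \<in> B" "s \<le> t" for s t
    using monoD[OF assms(1) that(2)] that(1) unfolding B_def by simp
  consider "B = {}" | "\<forall>t. t \<in> B" | "B \<noteq> {}" "\<exists>t. t \<notin> B" by blast
  then show ?thesis
  proof cases
    case 1
    with AB show ?thesis by auto
  next
    case 2
    with AB show ?thesis by auto
  next
    case 3
    then obtain b where b: "b \<notin> B" by blast
    have bdd: "bdd_below B"
    proof (rule bdd_belowI[of _ b])
      fix t assume "t \<in> B"
      then show "b \<le> t" using up[of t b] b linear[of b t] by blast
    qed
    \<comment> \<open>Whether the infimum itself belongs to \<open>B\<close> is unknown; this single
      point is discarded as a null set.\<close>
    have "AE t in lborel. t \<in> B \<longleftrightarrow> Inf B \<le> t"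
      using AE_lborel_singleton[of "Inf B"]
    proof eventually_elim
      case (elim t)
      have "t \<in> B" if "Inf B < t"
        using cInf_lessD[OF 3(1) that] up[OF _ less_imp_le] by blast
      moreover have "Inf B \<le> t" if "t \<in> B"
        using that bdd by (rule cInf_lower)
      ultimately show ?case
        using elim by (cases "Inf B < t") auto
    qed
    with AB have "AE t in lborel. t \<in> A \<longleftrightarrow> Inf B \<le> t" by eventually_elim simp
    then show ?thesis by blast
  qed
qed

text \<open>If \<open>A\<close> is almost everywhere equal to \<open>{s..}\<close>, then \<open>rises A\<close> and \<open>jump A = s\<close>. Expressing
  both through measures makes them measurable in parameters and insensitive to null sets.\<close>

definition rises :: "real set \<Rightarrow> bool" where
  "rises A \<longleftrightarrow> emeasure lborel ({0..} - A) < \<infinity> \<and> emeasure lborel ({..<0} \<inter> A) < \<infinity>"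

definition jump :: "real set \<Rightarrow> real" where
  "jump A = enn2real (emeasure lborel ({0..} - A)) - enn2real (emeasure lborel ({..<0} \<inter> A))"

lemma emeasure_lborel_halfline [simp]:
  "emeasure lborel {a::real..} = \<infinity>" "emeasure lborel {..<a::real} = \<infinity>"
proof -
  have *: "m = \<infinity>" if "\<And>n::nat. ennreal n \<le> m" for m :: ennreal
  proof (rule ccontr)
    assume "m \<noteq> \<infinity>"
    then obtain n :: nat where "m < of_nat n" using ennreal_Ex_less_of_nat by (metis infinity_ennreal_def top.not_eq_extremum)
    with that[of n] show False by (simp add: ennreal_of_nat_eq_real_of_nat)
  qed
  show "emeasure lborel {a::real..} = \<infinity>"
  proof (rule *)
    fix n :: nat
    have "emeasure lborel {a..a + n} \<le> emeasure lborel {a..}" by (rule emeasure_mono) auto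
    then show "ennreal n \<le> emeasure lborel {a..}" by simp
  qed
  show "emeasure lborel {..<a::real} = \<infinity>"
  proof (rule *)
    fix n :: nat
    have "emeasure lborel {a - n..<a} \<le> emeasure lborel {..<a}" by (rule emeasure_mono) auto
    then show "ennreal n \<le> emeasure lborel {..<a}" by simp
  qed
qed

lemma rises_jump_AE_eq:
  assumes "A \<in> sets borel" "B \<in> sets borel" "AE t in lborel. t \<in> A \<longleftrightarrow> t \<in> B"
  shows "rises A = rises B" "jump A = jump B"
proof -
  have "emeasure lborel ({0..} - A) = emeasure lborel ({0..} - B)"
    "emeasure lborel ({..<0} \<inter> A) = emeasure lborel ({..<0} \<inter> B)"
    using assms by (auto intro!: emeasure_eq_AE)
  then show "rises A = rises B" "jump A = jump B" by (simp_all add: rises_def jump_def)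
qed

text \<open>For the half-line starting at \<open>s\<close> the two lengths are the positive and
  negative parts of \<open>s\<close>. The empty set and a left half-line miss infinite length in the
  positive axis, while \<open>UNIV\<close> covers infinite length in the negative axis.\<close>

lemma rises_jump_simps:
  "\<not> rises {}" "\<not> rises UNIV" "rises {s..}" "jump {s..} = s" "\<not> rises {..<s}"
proof -
  show "\<not> rises {}" "\<not> rises UNIV" by (simp_all add: rises_def)
  have "{0..} - {s..} = {0..<s}" "{..<0} \<inter> {s..} = {s..<0}" by auto
  moreover have "emeasure lborel {0..<s} = ennreal (max 0 s)" "emeasure lborel {s..<0} = ennreal (max 0 (-s))"
    by (cases "s \<ge> 0"; simp)+
  ultimately show "rises {s..}" "jump {s..} = s"
    by (auto simp: rises_def jump_def)
  have "{0..} - {..<s} = {max 0 s..}" by auto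
  then show "\<not> rises {..<s}" by (simp add: rises_def)
qed

text \<open>Since \<psi>' vanishes wherever \<psi> vanishes on an open set, integrals over
  half-lines are integrals over bounded intervals, to which the fundamental theorem of calculus
  applies.\<close>

lemma lborel_integral_derivative_halfline:
  fixes \<psi> :: "real \<Rightarrow> real"
  assumes deriv: "\<And>t. (\<psi> has_real_derivative \<psi>' t) (at t)"
    and cont: "continuous_on UNIV \<psi>'" and supp: "\<And>t. \<bar>t\<bar> > R \<Longrightarrow> \<psi> t = 0"
  shows "integrable lborel (\<lambda>t. indicator {s..} t * \<psi>' t)"
    "(LINT t|lborel. indicator {s..} t * \<psi>' t) = - \<psi> s"
    "integrable lborel \<psi>'" "(LINT t|lborel. \<psi>' t) = 0"
proof -
  have supp': "\<psi>' t = 0" if "\<bar>t\<bar> > R" for t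
  proof -
    have "open {t::real. \<bar>t\<bar> > R}" by (intro open_Collect_less continuous_intros)
    then have "((\<lambda>_. 0) has_real_derivative \<psi>' t) (at t)"
      using that supp by (intro has_field_derivative_transform_within_open[OF deriv]) auto
    then show ?thesis by (metis DERIV_const DERIV_unique)
  qed
  have FTC: "has_bochner_integral lborel (\<lambda>t. \<psi>' t * indicator {a..b} t) (\<psi> b - \<psi> a)" if "a \<le> b" for a b
    using that cont deriv
    by (intro has_bochner_integral_FTC_Icc_real) (auto simp: continuous_on_eq_continuous_at)
  \<comment> \<open>The right end must exceed both \<open>R\<close> in absolute value and the left
    end \<open>a\<close>; \<open>R\<close> is allowed to be negative, hence the absolute
    value.\<close>
  have eq: "(\<lambda>t. \<psi>' t * indicator {a..max \<bar>R\<bar> a + 1} t) = (\<lambda>t. indicator {a..} t * \<psi>' t)" for a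
    using supp' by (auto simp: fun_eq_iff indicator_def)
  have half: "has_bochner_integral lborel (\<lambda>t. indicator {a..} t * \<psi>' t) (- \<psi> a)" for a
  proof -
    have "\<bar>max \<bar>R\<bar> a + 1\<bar> > R" "a \<le> max \<bar>R\<bar> a + 1" by linarith+
    then show ?thesis
      using FTC[of a "max \<bar>R\<bar> a + 1"] supp[of "max \<bar>R\<bar> a + 1"] unfolding eq by simp
  qed
  then show "integrable lborel (\<lambda>t. indicator {s..} t * \<psi>' t)"
    "(LINT t|lborel. indicator {s..} t * \<psi>' t) = - \<psi> s"
    by (auto simp: has_bochner_integral_iff)
  have "(\<lambda>t. indicator {- \<bar>R\<bar> - 1..} t * \<psi>' t) = \<psi>'"
    using supp' by (auto simp: fun_eq_iff indicator_def)
  then have "has_bochner_integral lborel \<psi>' 0"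
    using half[of "- \<bar>R\<bar> - 1"] supp[of "- \<bar>R\<bar> - 1"] by simp
  then show "integrable lborel \<psi>'" "(LINT t|lborel. \<psi>' t) = 0"
    by (auto simp: has_bochner_integral_iff)
qed

text \<open>Up to null sets \<open>A\<close> is empty, the whole line, a right half-line or a left
  half-line, and both sides of the equation are insensitive to null sets. At most one term on the
  right survives: the first for an upward jump, the second, through \<open>- A\<close>, for a
  downward jump.\<close>

lemma integral_derivative_over_monotone_set:
  fixes \<psi> :: "real \<Rightarrow> real"
  assumes A: "A \<in> sets borel" and h: "mono h \<or> antimono h"
      "AE t in lborel. (indicator A t :: real) = h t"
    and deriv: "\<And>t. (\<psi> has_real_derivative \<psi>' t) (at t)"
    and cont: "continuous_on UNIV \<psi>'" and supp: "\<And>t. \<bar>t\<bar> > R \<Longrightarrow> \<psi> t = 0"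
  shows "- (LINT t|lborel. indicator A t * \<psi>' t) =
    (if rises A then \<psi> (jump A) else 0) - (if rises (- A) then \<psi> (jump (- A)) else 0)"
proof -
  note half = lborel_integral_derivative_halfline[where R = R, OF deriv cont supp]
  have [measurable]: "\<psi>' \<in> borel_measurable borel" using cont by (rule borel_measurable_continuous_onI)
  have eq: ?thesis if B: "B \<in> sets borel" "AE t in lborel. t \<in> A \<longleftrightarrow> t \<in> B"
    and "- (LINT t|lborel. indicator B t * \<psi>' t) =
    (if rises B then \<psi> (jump B) else 0) - (if rises (- B) then \<psi> (jump (- B)) else 0)" for B
  proof -
    have [measurable]: "A \<in> sets borel" "B \<in> sets borel" by fact+
    have "(LINT t|lborel. indicator A t * \<psi>' t) = (LINT t|lborel. indicator B t * \<psi>' t)"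
      using B(2) by (intro integral_cong_AE) (auto simp: indicator_def elim!: eventually_mono)
    moreover have "AE t in lborel. t \<in> - A \<longleftrightarrow> t \<in> - B" using B(2) by eventually_elim simp
    ultimately show ?thesis
      using that(3) rises_jump_AE_eq[OF A B] rises_jump_AE_eq[of "- A" "- B"] by simp
  qed
  have compl: "- {s..} = {..<s}" "- {..<s} = {s..}" for s :: real by auto
  from h(1) have "(AE t in lborel. t \<notin> A) \<or> (AE t in lborel. t \<in> A) \<or>
      (\<exists>s. AE t in lborel. t \<in> A \<longleftrightarrow> s \<le> t) \<or> (\<exists>s. AE t in lborel. t \<in> A \<longleftrightarrow> t < s)"
  proof
    assume "mono h"
    from AE_indicator_mono_cases[OF this h(2)] show ?thesis by blast
  next
    assume "antimono h"
    \<comment> \<open>The decreasing case is the increasing one for the complement, whose indicator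
      agrees with \<open>1 - h\<close>.\<close>
    then have "mono (\<lambda>t. 1 - h t)" by (auto simp: mono_def antimono_def)
    moreover have "AE t in lborel. (indicator (- A) t :: real) = 1 - h t"
      using h(2) by eventually_elim (auto simp: indicator_def)
    ultimately have "(AE t in lborel. t \<notin> - A) \<or> (AE t in lborel. t \<in> - A) \<or>
      (\<exists>s. AE t in lborel. t \<in> - A \<longleftrightarrow> s \<le> t)"
      by (rule AE_indicator_mono_cases)
    moreover have "t \<in> - A \<longleftrightarrow> s \<le> t \<equiv> t \<in> A \<longleftrightarrow> t < s" for s t
      by (rule eq_reflection) auto
    ultimately show ?thesis by (simp only: Compl_iff not_not) blast
  qed
  then consider "AE t in lborel. t \<in> A \<longleftrightarrow> t \<in> {}" | "AE t in lborel. t \<in> A \<longleftrightarrow> t \<in> UNIV"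
    | s where "AE t in lborel. t \<in> A \<longleftrightarrow> t \<in> {s..}" | s where "AE t in lborel. t \<in> A \<longleftrightarrow> t \<in> {..<s}"
    by auto
  then show ?thesis
  proof cases
    case 1
    then show ?thesis by (rule eq[rotated]) (auto simp: rises_jump_simps)
  next
    case 2
    then show ?thesis by (rule eq[rotated]) (auto simp: rises_jump_simps half)
  next
    case 3
    then show ?thesis by (rule eq[rotated]) (auto simp: rises_jump_simps half compl)
  next
    case (4 s)
    have "indicator {..<s} t * \<psi>' t = \<psi>' t - indicator {s..} t * \<psi>' t" for t
      by (auto simp: indicator_def)
    then have "(LINT t|lborel. indicator {..<s} t * \<psi>' t) = \<psi> s"
      using half(1,2)[of s] half(3,4) by simp
    with 4 show ?thesis by (intro eq[of "{..<s}"]) (auto simp: rises_jump_simps compl)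
  qed
qed

section \<open>Radon measures\<close>

lemma integrable_radon:
  fixes \<phi> :: "'g::t2_space \<Rightarrow> real"
  assumes "radon_measure \<nu>" "continuous_on UNIV \<phi>" "compact K" "\<And>x. x \<notin> K \<Longrightarrow> \<phi> x = 0"
  shows "integrable \<nu> \<phi>"
proof -
  have sets: "sets \<nu> = sets borel" and fin: "emeasure \<nu> K < \<infinity>"
    using assms(1,3) by (auto simp: radon_measure_def)
  obtain M where M: "\<forall>x\<in>K. norm (\<phi> x) \<le> M"
    using compact_imp_bounded[OF compact_continuous_image[OF continuous_on_subset[OF assms(2)] assms(3)]]
    unfolding bounded_iff by auto
  show ?thesis
  proof (rule Bochner_Integration.integrable_bound)
    show "integrable \<nu> (\<lambda>x. M * indicator K x)"
      using fin sets assms(3)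
      by (intro integrable_mult_right integrable_real_indicator) (auto simp: borel_closed compact_imp_closed)
    show "\<phi> \<in> borel_measurable \<nu>"
      unfolding measurable_cong_sets[OF sets refl] using assms(2) by (rule borel_measurable_continuous_onI)
    show "AE x in \<nu>. norm (\<phi> x) \<le> norm (M * indicator K x)"
    proof (rule AE_I2)
      fix x
      show "norm (\<phi> x) \<le> norm (M * indicator K x)"
        using M assms(4)[of x] by (cases "x \<in> K") (auto intro: order_trans)
    qed
  qed
qed

text \<open>Integrals with respect to the sum are first computed for nonnegative functions, by
  induction from indicators, and then for \<phi> by splitting it into positive and negative
  parts.\<close>

lemma radon_measure_add:
  fixes M N :: "'g::t2_space measure"
  assumes "radon_measure M" "radon_measure N"
  obtains L where "radon_measure L"
    "\<And>\<phi> K. continuous_on UNIV \<phi> \<Longrightarrow> compact K \<Longrightarrow> (\<And>x. x \<notin> K \<Longrightarrow> \<phi> x = 0) \<Longrightarrow>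
       (LINT x|L. \<phi> x :: real) = (LINT x|M. \<phi> x) + (LINT x|N. \<phi> x)"
proof -
  define L where "L = measure_of UNIV (sets (borel :: 'g measure)) (\<lambda>A. emeasure M A + emeasure N A)"
  have sM: "sets M = sets borel" and sN: "sets N = sets borel"
    using assms by (auto simp: radon_measure_def)
  have sL: "sets L = sets borel"
    unfolding L_def using sets.sets_measure_of_eq[of "borel :: 'g measure"] by simp
  have eL: "emeasure L A = emeasure M A + emeasure N A" if "A \<in> sets borel" for A
    unfolding L_def
  proof (rule emeasure_measure_of_sigma[OF _ _ _ that])
    show "sigma_algebra UNIV (sets (borel :: 'g measure))"
      using sets.sigma_algebra_axioms[of "borel :: 'g measure"] by simp
    show "positive (sets borel) (\<lambda>A. emeasure M A + emeasure N A)" by (simp add: positive_def)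
    show "countably_additive (sets borel) (\<lambda>A. emeasure M A + emeasure N A)"
      unfolding countably_additive_def
      by (auto simp: suminf_add[symmetric] suminf_emeasure sM sN)
  qed
  have nn: "(\<integral>\<^sup>+x. f x \<partial>L) = (\<integral>\<^sup>+x. f x \<partial>M) + (\<integral>\<^sup>+x. f x \<partial>N)"
    if "f \<in> borel_measurable borel" for f :: "'g \<Rightarrow> ennreal"
    using that
  proof (induction rule: borel_measurable_induct)
    case (set A)
    then show ?case using eL sL sM sN by simp
  next
    case (mult u c)
    then show ?case
      by (simp add: nn_integral_cmult measurable_cong_sets[OF sL refl] measurable_cong_sets[OF sM refl]
          measurable_cong_sets[OF sN refl] distrib_left)
  next
    case (add u v)
    then show ?case
      by (simp add: nn_integral_add measurable_cong_sets[OF sL refl] measurable_cong_sets[OF sM refl]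
          measurable_cong_sets[OF sN refl] ac_simps)
  next
    case (seq U)
    have *: "(\<integral>\<^sup>+x. (SUP i. U i x) \<partial>P) = (SUP i. \<integral>\<^sup>+x. U i x \<partial>P)" if "sets P = sets borel" for P :: "'g measure"
      using seq.hyps by (intro nn_integral_monotone_convergence_SUP) (auto simp: measurable_cong_sets[OF that refl])
    have "(SUP i. integral\<^sup>N M (U i) + integral\<^sup>N N (U i)) = (SUP i. integral\<^sup>N M (U i)) + (SUP i. integral\<^sup>N N (U i))"
      using \<open>incseq U\<close>
      by (intro ennreal_SUP_add) (auto simp: incseq_def le_fun_def intro!: nn_integral_mono)
    then show ?case using seq.hyps seq.IH * sL sM sN by (simp add: image_comp SUP_apply)
  qed (simp_all cong: nn_integral_cong)
  show ?thesis
  proof (rule that)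
    show radL: "radon_measure L"
      unfolding radon_measure_def
    proof (intro conjI allI impI sL)
      fix K :: "'g set" assume "compact K"
      then have "emeasure M K < \<infinity>" "emeasure N K < \<infinity>" "K \<in> sets borel"
        using assms by (simp_all add: radon_measure_def borel_closed compact_imp_closed)
      then show "emeasure L K < \<infinity>" by (simp add: eL)
    qed
    fix \<phi> :: "'g \<Rightarrow> real" and K assume \<phi>: "continuous_on UNIV \<phi>" "compact K" "\<And>x. x \<notin> K \<Longrightarrow> \<phi> x = 0"
    have int: "integrable L \<phi>" "integrable M \<phi>" "integrable N \<phi>"
      using integrable_radon[OF _ \<phi>] radL assms by blast+
    have m: "\<phi> \<in> borel_measurable borel" using \<phi>(1) by (rule borel_measurable_continuous_onI)
    \<comment> \<open>\<open>enn2real\<close> is additive only on finite values; compact support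
      provides this finiteness, as the measures themselves may be infinite.\<close>
    have fin: "(\<integral>\<^sup>+x. ennreal (\<phi> x) \<partial>P) < \<infinity> \<and> (\<integral>\<^sup>+x. ennreal (- \<phi> x) \<partial>P) < \<infinity>"
      if "integrable P \<phi>" for P
      using that unfolding real_integrable_def by (metis infinity_ennreal_def top.not_eq_extremum)
    show "(LINT x|L. \<phi> x) = (LINT x|M. \<phi> x) + (LINT x|N. \<phi> x)"
      using int[THEN fin] m
      by (simp add: real_lebesgue_integral_def[OF int(1)] real_lebesgue_integral_def[OF int(2)]
          real_lebesgue_integral_def[OF int(3)] nn enn2real_plus)
  qed
qed

lemma radon_measure_scale:
  assumes "radon_measure M" "c \<ge> 0"
  shows "radon_measure (density M (\<lambda>_. ennreal c))"
    "\<phi> \<in> borel_measurable borel \<Longrightarrow> (LINT x|density M (\<lambda>_. ennreal c). \<phi> x :: real) = c * (LINT x|M. \<phi> x)"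
proof -
  have sM: "sets M = sets borel" and fin: "\<And>K. compact K \<Longrightarrow> emeasure M K < \<infinity>"
    using assms by (auto simp: radon_measure_def)
  have "emeasure (density M (\<lambda>_. ennreal c)) K < \<infinity>" if "compact K" for K
  proof (cases "K \<in> sets M")
    case True
    then show ?thesis using fin[OF that] by (simp add: emeasure_density_const ennreal_mult_less_top)
  next
    \<comment> \<open>No separation axiom is assumed here, so a compact set may fail to be
      measurable; \<open>emeasure\<close> is then 0 by default.\<close>
    case False
    then show ?thesis by (simp add: emeasure_notin_sets)
  qed
  then show "radon_measure (density M (\<lambda>_. ennreal c))"
    using sM by (simp add: radon_measure_def)
  assume "\<phi> \<in> borel_measurable borel"
  then show "(LINT x|density M (\<lambda>_. ennreal c). \<phi> x) = c * (LINT x|M. \<phi> x)"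
    using assms(2) by (subst integral_density) (auto simp: measurable_cong_sets[OF sM refl])
qed

text \<open>The pair encoding of signed Radon measures from \<open>locally_finite_perimeter\<close>,
  phrased for an arbitrary functional so that sums and multiples can be formed.\<close>

definition signed_radon :: "('g::topological_space \<Rightarrow> real) set \<Rightarrow> (('g \<Rightarrow> real) \<Rightarrow> real) \<Rightarrow> bool" where
  "signed_radon C T \<longleftrightarrow> (\<exists>\<nu>1 \<nu>2. radon_measure \<nu>1 \<and> radon_measure \<nu>2 \<and>
     (\<forall>\<phi>\<in>C. T \<phi> = (LINT x|\<nu>1. \<phi> x) - (LINT x|\<nu>2. \<phi> x)))"

lemma signed_radon_zero: "signed_radon C (\<lambda>_. 0)"
proof -
  have "radon_measure (null_measure borel)" by (simp add: radon_measure_def)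
  then show ?thesis unfolding signed_radon_def
    by (intro exI[of _ "null_measure borel"]) simp
qed

lemma signed_radon_add:
  fixes C :: "('g::t2_space \<Rightarrow> real) set"
  assumes C: "\<And>\<phi>. \<phi> \<in> C \<Longrightarrow> continuous_on UNIV \<phi> \<and> (\<exists>K. compact K \<and> (\<forall>x. x \<notin> K \<longrightarrow> \<phi> x = 0))"
    and "signed_radon C S" "signed_radon C T"
  shows "signed_radon C (\<lambda>\<phi>. S \<phi> + T \<phi>)"
proof -
  obtain M1 M2 N1 N2 where r: "radon_measure M1" "radon_measure M2" "radon_measure N1" "radon_measure N2"
    and S: "\<forall>\<phi>\<in>C. S \<phi> = (LINT x|M1. \<phi> x) - (LINT x|M2. \<phi> x)"
    and T: "\<forall>\<phi>\<in>C. T \<phi> = (LINT x|N1. \<phi> x) - (LINT x|N2. \<phi> x)"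
    using assms(2,3) unfolding signed_radon_def by blast
  obtain L1 where L1: "radon_measure L1"
    "\<And>\<phi> K. continuous_on UNIV \<phi> \<Longrightarrow> compact K \<Longrightarrow> (\<And>x. x \<notin> K \<Longrightarrow> \<phi> x = 0) \<Longrightarrow>
       (LINT x|L1. \<phi> x :: real) = (LINT x|M1. \<phi> x) + (LINT x|N1. \<phi> x)"
    using radon_measure_add[OF r(1,3)] by blast
  obtain L2 where L2: "radon_measure L2"
    "\<And>\<phi> K. continuous_on UNIV \<phi> \<Longrightarrow> compact K \<Longrightarrow> (\<And>x. x \<notin> K \<Longrightarrow> \<phi> x = 0) \<Longrightarrow>
       (LINT x|L2. \<phi> x :: real) = (LINT x|M2. \<phi> x) + (LINT x|N2. \<phi> x)"
    using radon_measure_add[OF r(2,4)] by blast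
  have "S \<phi> + T \<phi> = (LINT x|L1. \<phi> x) - (LINT x|L2. \<phi> x)" if \<phi>: "\<phi> \<in> C" for \<phi>
  proof -
    obtain K where K: "continuous_on UNIV \<phi>" "compact K" "\<And>x. x \<notin> K \<Longrightarrow> \<phi> x = 0"
      using C[OF \<phi>] by blast
    show ?thesis using L1(2)[OF K] L2(2)[OF K] S T \<phi> by simp
  qed
  with L1(1) L2(1) show ?thesis unfolding signed_radon_def by blast
qed

text \<open>Both measures are multiplied by the absolute value of \<open>c\<close>; for negative
  \<open>c\<close> they also exchange their roles.\<close>

lemma signed_radon_scale:
  fixes C :: "('g::t2_space \<Rightarrow> real) set"
  assumes C: "\<And>\<phi>. \<phi> \<in> C \<Longrightarrow> continuous_on UNIV \<phi>" and "signed_radon C T"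
  shows "signed_radon C (\<lambda>\<phi>. c * T \<phi>)"
proof -
  obtain N1 N2 where r: "radon_measure N1" "radon_measure N2"
    and T: "\<forall>\<phi>\<in>C. T \<phi> = (LINT x|N1. \<phi> x) - (LINT x|N2. \<phi> x)"
    using assms(2) unfolding signed_radon_def by blast
  define D where "D N = density N (\<lambda>_. ennreal \<bar>c\<bar>)" for N :: "'g measure"
  have D: "radon_measure (D N1)" "radon_measure (D N2)"
    unfolding D_def using r by (auto intro: radon_measure_scale)
  have LD: "(LINT x|D N. \<phi> x) = \<bar>c\<bar> * (LINT x|N. \<phi> x)" if "\<phi> \<in> C" "radon_measure N" for \<phi> N
    unfolding D_def using C[OF that(1)] that(2)
    by (intro radon_measure_scale borel_measurable_continuous_onI) auto
  show ?thesis
  proof (cases "c \<ge> 0")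
    case True
    then have "\<forall>\<phi>\<in>C. c * T \<phi> = (LINT x|D N1. \<phi> x) - (LINT x|D N2. \<phi> x)"
      using T LD r by (simp add: right_diff_distrib)
    with D show ?thesis unfolding signed_radon_def by blast
  next
    case False
    then have "\<forall>\<phi>\<in>C. c * T \<phi> = (LINT x|D N2. \<phi> x) - (LINT x|D N1. \<phi> x)"
      using T LD r by (simp add: right_diff_distrib)
    with D show ?thesis unfolding signed_radon_def by blast
  qed
qed

section \<open>Flows disintegrating a measure\<close>

text \<open>Isolates the measure theory of one direction \<open>X\<close>: \<open>\<Phi> x t\<close>
  stands for \<open>x \<cdot> exp(tX)\<close> and \<nu> for \<open>\<mu>\<^sub>X\<close>,
  concentrated on the transversal \<open>N\<^sub>X\<close>. The last assumption is the
  normalization.\<close>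

locale flow_disintegration =
  fixes \<mu> \<nu> :: "'g::{t2_space,second_countable_topology} measure" and \<Phi> :: "'g \<Rightarrow> real \<Rightarrow> 'g"
  assumes finite_on_compact: "compact K \<Longrightarrow> emeasure \<mu> K < \<infinity>"
    and sigma_compact: "\<exists>K :: nat \<Rightarrow> 'g set. (\<forall>n. compact (K n)) \<and> (\<Union>n. K n) = UNIV"
    and continuous_flow: "continuous_on UNIV (\<lambda>(x, t). \<Phi> x t)"
    and flow_add: "\<Phi> (\<Phi> x s) t = \<Phi> x (s + t)"
    and flow_zero: "\<Phi> x 0 = x"
    and measurable_flow: "(\<lambda>(x, t). \<Phi> x t) \<in> \<nu> \<Otimes>\<^sub>M lborel \<rightarrow>\<^sub>M borel"
    and distr_flow: "distr (\<nu> \<Otimes>\<^sub>M lborel) borel (\<lambda>(x, t). \<Phi> x t) = \<mu>"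
begin

definition visits :: "'g set \<Rightarrow> 'g \<Rightarrow> real set" where
  "visits F x = {t. \<Phi> x t \<in> F}"

definition tube :: "'g set \<Rightarrow> 'g set" where
  "tube K = (\<lambda>(x, t). \<Phi> x t) ` (K \<times> {0..1})"

text \<open>A flow line meeting \<open>K\<close> spends at least unit time in \<open>tube K\<close>, so \<open>near K\<close> contains the
  base points of all such lines, while being measurable and of measure at most \<open>\<mu> (tube K)\<close>.\<close>

definition near :: "'g set \<Rightarrow> 'g set" where
  "near K = {x \<in> space \<nu>. 1 \<le> emeasure lborel (visits (tube K) x)}"

text \<open>With \<open>- F\<close> in place of \<open>F\<close> this is the measure of downward
  jumps. The condition \<open>rises\<close> is weaker than being a half-line up to null sets, but it
  is a measurable condition on the line, and the two agree on lines where \<open>F\<close> is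
  monotone.\<close>

definition jump_measure :: "'g set \<Rightarrow> 'g measure" where
  "jump_measure F = distr (restrict_space \<nu> {x \<in> space \<nu>. rises (visits F x)}) borel
     (\<lambda>x. \<Phi> x (jump (visits F x)))"

section \<open>Fubini along flow lines and time spent in compact sets\<close>

lemma sets_mu: "sets \<mu> = sets borel"
  unfolding distr_flow[symmetric] by (rule sets_distr)

lemma continuous_flow_line: "continuous_on UNIV (\<Phi> x)"
proof -
  have "continuous_on UNIV (\<lambda>t::real. (x, t))" by (intro continuous_intros)
  from continuous_on_compose2[OF continuous_flow this] show ?thesis by simp
qed

lemma visits_borel: "F \<in> sets borel \<Longrightarrow> visits F x \<in> sets borel"
proof -
  assume "F \<in> sets borel"
  then have "\<Phi> x -` F \<inter> space borel \<in> sets borel"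
    by (rule measurable_sets[OF borel_measurable_continuous_onI[OF continuous_flow_line]])
  then show ?thesis by (simp add: visits_def vimage_def)
qed

lemma visits_compl: "visits (- F) x = - visits F x"
  by (auto simp: visits_def)

lemma vimage_flow_sets:
  assumes "F \<in> sets borel" "C \<in> sets borel"
  shows "(\<lambda>(x, t). \<Phi> x t) -` F \<inter> (space \<nu> \<times> C) \<in> sets (\<nu> \<Otimes>\<^sub>M lborel)"
proof -
  have "(\<lambda>(x, t). \<Phi> x t) -` F \<inter> space (\<nu> \<Otimes>\<^sub>M lborel) \<in> sets (\<nu> \<Otimes>\<^sub>M lborel)"
    using measurable_flow assms(1) by (rule measurable_sets)
  moreover have "space \<nu> \<times> C \<in> sets (\<nu> \<Otimes>\<^sub>M lborel)"
    using assms(2) by (intro pair_measureI) auto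
  ultimately have "((\<lambda>(x, t). \<Phi> x t) -` F \<inter> space (\<nu> \<Otimes>\<^sub>M lborel)) \<inter> (space \<nu> \<times> C) \<in> sets (\<nu> \<Otimes>\<^sub>M lborel)"
    by (rule sets.Int)
  then show ?thesis by (simp add: space_pair_measure Int_assoc Times_Int_Times)
qed

lemma measurable_visits:
  assumes "F \<in> sets borel" "C \<in> sets borel"
  shows "(\<lambda>x. emeasure lborel (visits F x \<inter> C)) \<in> borel_measurable \<nu>"
proof -
  have "(\<lambda>x. emeasure lborel (Pair x -` ((\<lambda>(x, t). \<Phi> x t) -` F \<inter> (space \<nu> \<times> C)))) \<in> borel_measurable \<nu>"
    using vimage_flow_sets[OF assms] by (rule lborel.measurable_emeasure_Pair)
  moreover have "Pair x -` ((\<lambda>(x, t). \<Phi> x t) -` F \<inter> (space \<nu> \<times> C)) = visits F x \<inter> C" if "x \<in> space \<nu>" for x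
    using that by (auto simp: visits_def)
  ultimately show ?thesis by (simp cong: measurable_cong)
qed

text \<open>Tonelli with time as the inner variable, which rests on sigma-finiteness of
  \<open>lborel\<close>. The sigma-finiteness of \<nu> is deduced from this formula later, so the
  formula must not presuppose it.\<close>

lemma emeasure_eq_nn_integral_visits:
  assumes "F \<in> sets borel"
  shows "emeasure \<mu> F = (\<integral>\<^sup>+x. emeasure lborel (visits F x) \<partial>\<nu>)"
proof -
  have "emeasure \<mu> F = emeasure (\<nu> \<Otimes>\<^sub>M lborel) ((\<lambda>(x, t). \<Phi> x t) -` F \<inter> (space \<nu> \<times> UNIV))"
    unfolding distr_flow[symmetric]
    using assms measurable_flow by (simp add: emeasure_distr space_pair_measure)
  also have "\<dots> = (\<integral>\<^sup>+x. emeasure lborel (Pair x -` ((\<lambda>(x, t). \<Phi> x t) -` F \<inter> (space \<nu> \<times> UNIV))) \<partial>\<nu>)"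
    using vimage_flow_sets[OF assms, of UNIV] by (intro lborel.emeasure_pair_measure_alt) auto
  also have "\<dots> = (\<integral>\<^sup>+x. emeasure lborel (visits F x) \<partial>\<nu>)"
    by (intro nn_integral_cong arg_cong[where f = "emeasure lborel"]) (auto simp: visits_def)
  finally show ?thesis .
qed

text \<open>Allows a set to be changed by a null set without affecting its traces on almost all
  lines, up to null sets of times.\<close>

lemma null_set_visits:
  assumes "F \<in> null_sets \<mu>"
  shows "AE x in \<nu>. AE t in lborel. \<Phi> x t \<notin> F"
proof -
  have F: "F \<in> sets borel" using assms sets_mu by auto
  have "(\<integral>\<^sup>+x. emeasure lborel (visits F x) \<partial>\<nu>) = 0"
    using assms emeasure_eq_nn_integral_visits[OF F] by auto
  then have "AE x in \<nu>. emeasure lborel (visits F x) = 0"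
    using measurable_visits[OF F, of UNIV] by (simp add: nn_integral_0_iff_AE)
  then show ?thesis
  proof eventually_elim
    case (elim x)
    then show ?case
      using visits_borel[OF F] by (intro AE_I[of _ _ "visits F x"]) (auto simp: visits_def)
  qed
qed

lemma compact_tube: "compact K \<Longrightarrow> compact (tube K)"
  unfolding tube_def
proof (rule compact_continuous_image)
  show "continuous_on (K \<times> {0..1}) (\<lambda>(x, t). \<Phi> x t)"
    using continuous_flow by (rule continuous_on_subset) simp
  show "compact K \<Longrightarrow> compact (K \<times> {0..1::real})"
    by (intro compact_Times) auto
qed

lemma compact_borel: "compact (K :: 'g set) \<Longrightarrow> K \<in> sets borel"
  by (simp add: borel_closed compact_imp_closed)

lemma visits_tube: "\<Phi> x t \<in> K \<Longrightarrow> {t..t + 1} \<subseteq> visits (tube K) x"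
proof (safe)
  fix s assume "\<Phi> x t \<in> K" "s \<in> {t..t + 1}"
  moreover have "\<Phi> x s = \<Phi> (\<Phi> x t) (s - t)" by (simp add: flow_add)
  ultimately show "s \<in> visits (tube K) x"
    unfolding visits_def tube_def by (force intro!: image_eqI[of _ _ "(\<Phi> x t, s - t)"])
qed

lemma near_I:
  assumes "compact K" "x \<in> space \<nu>" "\<Phi> x t \<in> K"
  shows "x \<in> near K"
proof -
  have "emeasure lborel {t..t + 1} \<le> emeasure lborel (visits (tube K) x)"
    using visits_tube[OF assms(3)] visits_borel[OF compact_borel[OF compact_tube[OF assms(1)]]]
    by (intro emeasure_mono) auto
  then show ?thesis using assms(2) by (simp add: near_def)
qed

lemma near_sets: "compact K \<Longrightarrow> near K \<in> sets \<nu>"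
proof -
  assume "compact K"
  then have [measurable]: "(\<lambda>x. emeasure lborel (visits (tube K) x)) \<in> borel_measurable \<nu>"
    using measurable_visits[OF compact_borel[OF compact_tube], of K UNIV] by simp
  show ?thesis unfolding near_def by measurable
qed

text \<open>Markov's inequality with threshold 1 for the time spent in
  \<open>tube K\<close>.\<close>

lemma emeasure_near:
  assumes "compact K" shows "emeasure \<nu> (near K) < \<infinity>"
proof -
  have "emeasure \<nu> (near K) = (\<integral>\<^sup>+x. indicator (near K) x \<partial>\<nu>)"
    using near_sets[OF assms] by simp
  also have "\<dots> \<le> (\<integral>\<^sup>+x. emeasure lborel (visits (tube K) x) \<partial>\<nu>)"
    by (intro nn_integral_mono) (auto simp: near_def indicator_def)
  also have "\<dots> = emeasure \<mu> (tube K)"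
    by (rule emeasure_eq_nn_integral_visits[OF compact_borel[OF compact_tube[OF assms]], symmetric])
  also have "\<dots> < \<infinity>"
    using finite_on_compact[OF compact_tube[OF assms]] .
  finally show ?thesis .
qed

text \<open>A base point of the transversal lies on its own line at time 0, so the sets
  \<open>near (K n)\<close> cover the transversal when the \<open>K n\<close> exhaust the
  group.\<close>

lemma sigma_finite_nu: "sigma_finite_measure \<nu>"
proof
  obtain K :: "nat \<Rightarrow> 'g set" where K: "\<And>n. compact (K n)" "(\<Union>n. K n) = UNIV"
    using sigma_compact by auto
  have "x \<in> (\<Union>n. near (K n))" if "x \<in> space \<nu>" for x
  proof -
    have "x \<in> (\<Union>n. K n)" by (simp only: K(2) UNIV_I)
    then obtain n where "\<Phi> x 0 \<in> K n" by (auto simp: flow_zero)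
    with near_I[OF K(1) that] show ?thesis by auto
  qed
  then have "(\<Union>n. near (K n)) = space \<nu>" by (auto simp: near_def)
  then show "\<exists>A. countable A \<and> A \<subseteq> sets \<nu> \<and> \<Union>A = space \<nu> \<and> (\<forall>a\<in>A. emeasure \<nu> a \<noteq> \<infinity>)"
    using near_sets[OF K(1)] emeasure_near[OF K(1)]
    by (intro exI[of _ "range (\<lambda>n. near (K n))"]) (auto simp: less_top)
qed

text \<open>A flow line need not be a proper curve a priori; finiteness of \<open>\<mu> (tube K)\<close> makes almost all
  of them leave \<open>K\<close> for good.\<close>

lemma AE_leaves_compact:
  assumes "compact K"
  shows "AE x in \<nu>. \<exists>R. \<forall>t. \<bar>t\<bar> > R \<longrightarrow> \<Phi> x t \<notin> K"
proof -
  have T: "tube K \<in> sets borel" using compact_borel[OF compact_tube[OF assms]] .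
  have "(\<integral>\<^sup>+x. emeasure lborel (visits (tube K) x) \<partial>\<nu>) \<noteq> \<infinity>"
    using finite_on_compact[OF compact_tube[OF assms]] emeasure_eq_nn_integral_visits[OF T] by simp
  then have "AE x in \<nu>. emeasure lborel (visits (tube K) x) \<noteq> \<infinity>"
    using measurable_visits[OF T, of UNIV] by (intro nn_integral_PInf_AE) auto
  then show ?thesis
  proof eventually_elim
    case (elim x)
    define A where "A n = visits (tube K) x \<inter> {t. \<bar>t\<bar> \<ge> real n}" for n
    have A: "A n \<in> sets borel" for n
      using visits_borel[OF T] by (auto simp: A_def)
    have "emeasure lborel (A n) \<le> emeasure lborel (visits (tube K) x)" for n
      using visits_borel[OF T] by (intro emeasure_mono) (auto simp: A_def)
    then have "emeasure lborel (A n) \<noteq> \<infinity>" for n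
      using elim by (metis infinity_ennreal_def neq_top_trans)
    \<comment> \<open>Continuity from above: finite total time forces the time spent in
      \<open>tube K\<close> at times beyond \<open>n\<close> to tend to 0.\<close>
    then have "(\<lambda>n. emeasure lborel (A n)) \<longlonglongrightarrow> emeasure lborel (\<Inter>n. A n)"
      using A by (intro Lim_emeasure_decseq) (auto simp: decseq_def A_def)
    moreover have "(\<Inter>n. A n) = {}"
    proof (rule equals0I)
      fix t assume "t \<in> (\<Inter>n. A n)"
      then have "t \<in> A n" for n by simp
      moreover obtain n where "\<bar>t\<bar> < real n" using reals_Archimedean2 by blast
      ultimately show False by (metis A_def IntD2 mem_Collect_eq not_less)
    qed
    ultimately have "(\<lambda>n. emeasure lborel (A n)) \<longlonglongrightarrow> 0" by (simp only: emeasure_empty)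
    then have "\<forall>\<^sub>F n in sequentially. emeasure lborel (A n) < 1"
      by (rule order_tendstoD) simp
    then obtain n where n: "emeasure lborel (A n) < 1"
      unfolding eventually_sequentially by blast
    \<comment> \<open>A visit to \<open>K\<close> at time \<open>t\<close> would put
      \<open>{t..t + 1}\<close>, of length 1, into \<open>A n\<close>. The margin 1 keeps
      \<open>t + 1\<close> at distance at least \<open>n\<close> from 0 when \<open>t\<close> is
      negative.\<close>
    have "\<Phi> x t \<notin> K" if "\<bar>t\<bar> > real n + 1" for t
    proof
      assume "\<Phi> x t \<in> K"
      then have "{t..t + 1} \<subseteq> A n" using visits_tube[of x t K] that by (auto simp: A_def)
      then have "emeasure lborel {t..t + 1} \<le> emeasure lborel (A n)"
        by (rule emeasure_mono) (simp add: A)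
      with n show False by simp
    qed
    then show ?case by blast
  qed
qed

section \<open>Jump measures and integration by parts along the flow\<close>

lemma measurable_rises_jump:
  assumes F: "F \<in> sets borel"
  shows "{x \<in> space \<nu>. rises (visits F x)} \<in> sets \<nu>"
    and "(\<lambda>x. \<Phi> x (jump (visits F x))) \<in> \<nu> \<rightarrow>\<^sub>M borel"
proof -
  have eq: "{0..} - visits F x = visits (- F) x \<inter> {0..}" "{..<0} \<inter> visits F x = visits F x \<inter> {..<0}" for x
    by (auto simp: visits_def)
  have [measurable]: "(\<lambda>x. emeasure lborel ({0..} - visits F x)) \<in> borel_measurable \<nu>"
    "(\<lambda>x. emeasure lborel ({..<0} \<inter> visits F x)) \<in> borel_measurable \<nu>"
    unfolding eq using F by (auto intro!: measurable_visits)
  show "{x \<in> space \<nu>. rises (visits F x)} \<in> sets \<nu>" unfolding rises_def by measurable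
  have "(\<lambda>x. jump (visits F x)) \<in> \<nu> \<rightarrow>\<^sub>M lborel" unfolding jump_def by measurable
  then have "(\<lambda>x. (\<lambda>(x, t). \<Phi> x t) (x, jump (visits F x))) \<in> \<nu> \<rightarrow>\<^sub>M borel"
    by (intro measurable_compose[OF _ measurable_flow] measurable_Pair) auto
  then show "(\<lambda>x. \<Phi> x (jump (visits F x))) \<in> \<nu> \<rightarrow>\<^sub>M borel" by simp
qed

text \<open>The jump point lies on the line through \<open>x\<close>, so if it falls in
  \<open>K\<close> then \<open>x\<close> is in \<open>near K\<close>, which has finite
  measure.\<close>

lemma radon_jump_measure:
  assumes F: "F \<in> sets borel"
  shows "radon_measure (jump_measure F)"
  unfolding radon_measure_def
proof (intro conjI allI impI)
  show "sets (jump_measure F) = sets borel" by (simp add: jump_measure_def)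
  fix K :: "'g set" assume K: "compact K"
  define S where "S = {x \<in> space \<nu>. rises (visits F x)}"
  have S: "S \<in> sets \<nu>" unfolding S_def by (rule measurable_rises_jump[OF F])
  have "emeasure (jump_measure F) K =
      emeasure (restrict_space \<nu> S) ((\<lambda>x. \<Phi> x (jump (visits F x))) -` K \<inter> space (restrict_space \<nu> S))"
    unfolding jump_measure_def S_def[symmetric]
    using compact_borel[OF K] measurable_restrict_space1[OF measurable_rises_jump(2)[OF F]]
    by (intro emeasure_distr) auto
  also have "\<dots> = emeasure \<nu> ((\<lambda>x. \<Phi> x (jump (visits F x))) -` K \<inter> space (restrict_space \<nu> S))"
    using S by (intro emeasure_restrict_space) (auto simp: space_restrict_space)
  also have "\<dots> \<le> emeasure \<nu> (near K)"
    using near_I[OF K] near_sets[OF K] by (intro emeasure_mono) (auto simp: space_restrict_space)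
  also have "\<dots> < \<infinity>" using emeasure_near[OF K] .
  finally show "emeasure (jump_measure F) K < \<infinity>" .
qed

lemma integral_jump_measure:
  fixes \<phi> :: "'g \<Rightarrow> real"
  assumes F: "F \<in> sets borel" and \<phi>: "continuous_on UNIV \<phi>" and K: "compact K" "\<And>x. x \<notin> K \<Longrightarrow> \<phi> x = 0"
  shows "integrable \<nu> (\<lambda>x. if rises (visits F x) then \<phi> (\<Phi> x (jump (visits F x))) else 0)" (is "integrable \<nu> ?f")
    and "(LINT x|jump_measure F. \<phi> x) =
      (LINT x|\<nu>. (if rises (visits F x) then \<phi> (\<Phi> x (jump (visits F x))) else 0))"
proof -
  define S where "S = {x \<in> space \<nu>. rises (visits F x)}"
  have S[measurable]: "S \<in> sets \<nu>" unfolding S_def by (rule measurable_rises_jump[OF F])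
  note [measurable] = measurable_rises_jump(2)[OF F] borel_measurable_continuous_onI[OF \<phi>] near_sets[OF K(1)]
  have f_eq: "?f x = indicator S x *\<^sub>R \<phi> (\<Phi> x (jump (visits F x)))" if "x \<in> space \<nu>" for x
    using that by (auto simp: S_def)
  obtain M where M: "\<And>x. \<bar>\<phi> x\<bar> \<le> M" "M \<ge> 0"
  proof -
    have "bounded (\<phi> ` K)"
      using K(1) \<phi> by (meson compact_continuous_image compact_imp_bounded continuous_on_subset subset_UNIV)
    then obtain M where "\<forall>x\<in>K. norm (\<phi> x) \<le> M" unfolding bounded_iff by auto
    then have "\<bar>\<phi> x\<bar> \<le> max M 0" for x using K(2)[of x] by (cases "x \<in> K") (auto intro: le_max_iff_disj[THEN iffD2])
    then show ?thesis using that[of "max M 0"] by auto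
  qed
  have "integrable \<nu> (\<lambda>x. indicator S x *\<^sub>R \<phi> (\<Phi> x (jump (visits F x))))"
  proof (rule Bochner_Integration.integrable_bound)
    show "integrable \<nu> (\<lambda>x. M * indicator (near K) x)"
      using emeasure_near[OF K(1)] near_sets[OF K(1)] by (intro integrable_mult_right) auto
    show "AE x in \<nu>. norm (indicator S x *\<^sub>R \<phi> (\<Phi> x (jump (visits F x)))) \<le> norm (M * indicator (near K) x)"
    proof (rule AE_I2)
      fix x assume "x \<in> space \<nu>"
      then show "norm (indicator S x *\<^sub>R \<phi> (\<Phi> x (jump (visits F x)))) \<le> norm (M * indicator (near K) x)"
        using near_I[OF K(1)] M K(2) by (auto simp: indicator_def)
    qed
  qed measurable
  then show "integrable \<nu> ?f" using f_eq by (simp cong: Bochner_Integration.integrable_cong)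
  have "(LINT x|jump_measure F. \<phi> x) = (LINT x|restrict_space \<nu> S. \<phi> (\<Phi> x (jump (visits F x))))"
    unfolding jump_measure_def S_def[symmetric]
    by (intro integral_distr measurable_restrict_space1) measurable
  also have "\<dots> = (LINT x|\<nu>. indicator S x *\<^sub>R \<phi> (\<Phi> x (jump (visits F x))))"
    using S by (intro integral_restrict_space) auto
  also have "\<dots> = (LINT x|\<nu>. ?f x)"
    using f_eq by (intro Bochner_Integration.integral_cong) auto
  finally show "(LINT x|jump_measure F. \<phi> x) = (LINT x|\<nu>. ?f x)" .
qed

text \<open>Fubini turns the left side into integrals over lines, where the one-dimensional formula
  applies: almost every line is monotone and leaves \<open>K\<close> for good. Here \<open>g\<close>
  is the derivative of \<phi> along the flow.\<close>

lemma integral_derivative_monotone: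
  fixes \<phi> g :: "'g \<Rightarrow> real"
  assumes F: "F \<in> sets borel"
    and mono: "AE x in \<nu>. \<exists>h. (mono h \<or> antimono h) \<and> (AE t in lborel. (indicator F (\<Phi> x t) :: real) = h t)"
    and \<phi>: "continuous_on UNIV \<phi>" and g: "continuous_on UNIV g"
    and K: "compact K" "\<And>x. x \<notin> K \<Longrightarrow> \<phi> x = 0" "\<And>x. x \<notin> K \<Longrightarrow> g x = 0"
    and deriv: "\<And>x. ((\<lambda>t. \<phi> (\<Phi> x t)) has_real_derivative g x) (at 0)"
  shows "- (LINT x|\<mu>. indicator F x * g x) =
    (LINT x|jump_measure F. \<phi> x) - (LINT x|jump_measure (- F). \<phi> x)"
proof -
  interpret \<nu>: sigma_finite_measure \<nu> by (rule sigma_finite_nu)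
  interpret P: pair_sigma_finite \<nu> lborel ..
  note [measurable] = measurable_flow borel_measurable_continuous_onI[OF g] F compact_borel[OF K(1)]
  have CF: "- F \<in> sets borel" using F by auto
  have "radon_measure \<mu>" using sets_mu finite_on_compact by (simp add: radon_measure_def)
  from integrable_radon[OF this g K(1,3)] have "integrable \<mu> g" .
  from integrable_mult_indicator[OF _ this, of F] have int: "integrable \<mu> (\<lambda>x. indicator F x * g x)"
    using F sets_mu by simp
  define f where "f x t = indicator (visits F x) t * g (\<Phi> x t)" for x t
  have f_eq: "(\<lambda>p. indicator F (case p of (x, t) \<Rightarrow> \<Phi> x t) * g (case p of (x, t) \<Rightarrow> \<Phi> x t)) = (\<lambda>(x, t). f x t)"
    by (auto simp: f_def visits_def indicator_def)
  have intf: "integrable (\<nu> \<Otimes>\<^sub>M lborel) (\<lambda>(x, t). f x t)"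
    using int unfolding distr_flow[symmetric] by (subst (asm) integrable_distr_eq) (auto simp: f_eq)
  have "(LINT x|\<mu>. indicator F x * g x) = (LINT p|(\<nu> \<Otimes>\<^sub>M lborel). (\<lambda>(x, t). f x t) p)"
    unfolding distr_flow[symmetric] by (subst integral_distr) (auto simp: f_eq)
  also have "\<dots> = (LINT x|\<nu>. LINT t|lborel. f x t)"
    using P.integral_fst[OF intf] by simp
  finally have 1: "- (LINT x|\<mu>. indicator F x * g x) = (LINT x|\<nu>. - (LINT t|lborel. f x t))"
    by simp
  define up where "up A x = (if rises (visits A x) then \<phi> (\<Phi> x (jump (visits A x))) else 0)" for A x
  note up = integral_jump_measure[OF F \<phi> K(1,2), folded up_def] integral_jump_measure[OF CF \<phi> K(1,2), folded up_def]
  have "(LINT x|\<nu>. - (LINT t|lborel. f x t)) = (LINT x|\<nu>. up F x - up (- F) x)"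
  proof (rule integral_cong_AE)
    show "(\<lambda>x. - (LINT t|lborel. f x t)) \<in> borel_measurable \<nu>"
      using P.integrable_fst[OF intf] by auto
    show "(\<lambda>x. up F x - up (- F) x) \<in> borel_measurable \<nu>"
      using up(1,3) by auto
    show "AE x in \<nu>. - (LINT t|lborel. f x t) = up F x - up (- F) x"
      using mono AE_leaves_compact[OF K(1)]
    proof eventually_elim
      case (elim x)
      obtain h where h: "mono h \<or> antimono h" "AE t in lborel. (indicator F (\<Phi> x t) :: real) = h t"
        using elim(1) by blast
      obtain R where R: "\<And>t. \<bar>t\<bar> > R \<Longrightarrow> \<Phi> x t \<notin> K" using elim(2) by blast
      \<comment> \<open>The derivative is assumed only at time 0; restarting the flow at
        \<open>\<Phi> x t\<close> transports it to time \<open>t\<close>.\<close>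
      have "((\<lambda>t. \<phi> (\<Phi> x t)) has_real_derivative g (\<Phi> x t)) (at t)" for t
      proof -
        have "((\<lambda>s. \<phi> (\<Phi> x (s + t))) has_real_derivative g (\<Phi> x t)) (at 0)"
          using deriv[of "\<Phi> x t"] by (simp add: flow_add add.commute)
        then show ?thesis using DERIV_shift[of "\<lambda>t. \<phi> (\<Phi> x t)" _ 0 t] by simp
      qed
      moreover have "AE t in lborel. (indicator (visits F x) t :: real) = h t"
        using h(2) by (simp add: visits_def indicator_def)
      moreover have "continuous_on UNIV (\<lambda>t. g (\<Phi> x t))"
        using continuous_on_compose2[OF g continuous_flow_line] by simp
      ultimately have "- (LINT t|lborel. indicator (visits F x) t * g (\<Phi> x t)) =
        (if rises (visits F x) then \<phi> (\<Phi> x (jump (visits F x))) else 0) -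
        (if rises (- visits F x) then \<phi> (\<Phi> x (jump (- visits F x))) else 0)"
        using h(1) K(2) R visits_borel[OF F]
        by (intro integral_derivative_over_monotone_set[where h = h and R = R]) auto
      then show ?case by (simp add: f_def up_def visits_compl)
    qed
  qed
  also have "\<dots> = (LINT x|jump_measure F. \<phi> x) - (LINT x|jump_measure (- F). \<phi> x)"
    using up by simp
  finally show ?thesis using 1 by simp
qed

end

section \<open>Sets of full measure in a sphere\<close>

lemma subspace_lebesgue_orthonormal:
  assumes "subspace (V :: 'a::euclidean_space set)"
  obtains B where "finite B" "span B = V" "pairwise orthogonal B" "\<And>b. b \<in> B \<Longrightarrow> norm b = 1"
    "subspace_lebesgue V = distr (PiM B (\<lambda>_. lborel)) borel (\<lambda>u. \<Sum>b\<in>B. u b *\<^sub>R b)"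
proof -
  define Q where "Q B \<longleftrightarrow> B \<subseteq> V \<and> pairwise orthogonal B \<and> (\<forall>b\<in>B. norm b = 1) \<and>
    independent B \<and> span B = V" for B
  obtain B where B: "B \<subseteq> V" "pairwise orthogonal B" "\<And>b. b \<in> B \<Longrightarrow> norm b = 1"
    "independent B" "card B = dim V" "span B = V"
    by (rule orthonormal_basis_subspace[OF assms]) blast
  then have "Q B" unfolding Q_def by blast
  then have "Q (SOME B. Q B)" by (rule someI)
  moreover have "subspace_lebesgue V =
      distr (PiM (SOME B. Q B) (\<lambda>_. lborel)) borel (\<lambda>u. \<Sum>b\<in>(SOME B. Q B). u b *\<^sub>R b)"
    unfolding subspace_lebesgue_def Q_def Let_def ..
  ultimately show ?thesis
    using that[of "SOME B. Q B"] finiteI_independent unfolding Q_def by blast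
qed

text \<open>In orthonormal coordinates a neighbourhood of \<open>v\<close> in \<open>V\<close>
  contains a box with sides of positive length, whose measure is their product.\<close>

lemma emeasure_subspace_lebesgue_pos:
  assumes V: "subspace (V :: 'a::euclidean_space set)" and v: "v \<in> V" "v \<in> U" and U: "open U"
    and A: "A \<in> sets borel" "V \<inter> U \<subseteq> A"
  shows "emeasure (subspace_lebesgue V) A \<noteq> 0"
proof -
  obtain B where B: "finite B" "span B = V" "pairwise orthogonal B" "\<And>b. b \<in> B \<Longrightarrow> norm b = 1"
    and eq: "subspace_lebesgue V = distr (PiM B (\<lambda>_. lborel)) borel (\<lambda>u. \<Sum>b\<in>B. u b *\<^sub>R b)"
    by (rule subspace_lebesgue_orthonormal[OF V]) blast
  let ?P = "PiM B (\<lambda>_. lborel :: real measure)" and ?s = "\<lambda>u. \<Sum>b\<in>B. u b *\<^sub>R b"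
  have meas: "?s \<in> ?P \<rightarrow>\<^sub>M borel" by measurable
  obtain e where e: "e > 0" "ball v e \<subseteq> U" using U v(2) open_contains_ball by blast
  \<comment> \<open>The coordinate errors add up to at most \<open>card B * d\<close>; the summand 1
    makes this strictly less than \<open>e\<close> and avoids division by zero when \<open>B\<close>
    is empty.\<close>
  define d where "d = e / (card B + 1)"
  have d: "d > 0" "card B * d < e" using e(1) by (auto simp: d_def field_simps)
  define box where "box = PiE B (\<lambda>b. {v \<bullet> b - d<..<v \<bullet> b + d})"
  have "box \<subseteq> ?s -` A \<inter> space ?P"
  proof
    fix u assume u: "u \<in> box"
    have "?s u - v = ?s u - (\<Sum>b\<in>B. (v \<bullet> b) *\<^sub>R b)"
      using orthonormal_basis_expand[OF B(3,4) _ B(1)] v(1) B(2) by simp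
    also have "\<dots> = (\<Sum>b\<in>B. (u b - v \<bullet> b) *\<^sub>R b)"
      by (simp add: sum_subtractf scaleR_diff_left)
    also have "norm \<dots> \<le> (\<Sum>b\<in>B. d)"
    proof (rule sum_norm_le)
      fix b assume b: "b \<in> B"
      then have "\<bar>u b - v \<bullet> b\<bar> < d" using u by (force simp: box_def PiE_iff abs_less_iff)
      then show "norm ((u b - v \<bullet> b) *\<^sub>R b) \<le> d" using B(4)[OF b] by simp
    qed
    also have "\<dots> < e" using d by simp
    finally have "?s u \<in> ball v e" by (simp add: dist_norm norm_minus_commute)
    moreover have "?s u \<in> V"
      unfolding B(2)[symmetric] by (intro span_sum span_scale span_base)
    ultimately show "u \<in> ?s -` A \<inter> space ?P"
      using e(2) A(2) u by (auto simp: box_def space_PiM PiE_iff)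
  qed
  then have le: "emeasure ?P box \<le> emeasure ?P (?s -` A \<inter> space ?P)"
    using meas A(1) by (intro emeasure_mono measurable_sets) auto
  interpret product_sigma_finite "\<lambda>_ :: 'a. lborel :: real measure" ..
  have "emeasure ?P box = (\<Prod>b\<in>B. emeasure lborel {v \<bullet> b - d<..<v \<bullet> b + d})"
    unfolding box_def using B(1) by (intro emeasure_PiM) auto
  also have "\<dots> \<noteq> 0" using B(1) d(1) by simp
  finally have "emeasure ?P (?s -` A \<inter> space ?P) \<noteq> 0"
    using le by (metis le_zero_eq)
  then show ?thesis using meas A(1) unfolding eq by (simp add: emeasure_distr)
qed

text \<open>If the span \<open>W\<close> were smaller than \<open>V\<close>, the part of the open
  unit ball of \<open>V\<close> outside \<open>W\<close> would be nonempty and relatively open,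
  hence of positive measure. Since \<open>W\<close> is closed under scaling, this part projects
  radially to unit vectors outside \<open>W\<close>, all of which belong to the exceptional null
  set.\<close>

lemma span_AE_sphere:
  assumes V: "subspace (V :: 'a::euclidean_space set)" and P: "AE X in sphere_measure V. P X"
  shows "V \<subseteq> span {X \<in> unit_sphere V. P X}"
proof (rule ccontr)
  let ?W = "span {X \<in> unit_sphere V. P X}" and ?C = "V \<inter> cball 0 1 - {0}"
  let ?R = "restrict_space (subspace_lebesgue V) ?C" and ?S = "restrict_space borel (unit_sphere V)"
  assume "\<not> V \<subseteq> ?W"
  then obtain w where w: "w \<in> V" "w \<notin> ?W" by blast
  \<comment> \<open>Rescaling to norm 1/2 brings the vector into the open unit ball without entering
    \<open>?W\<close>.\<close>
  define v where "v = (1 / (2 * norm w)) *\<^sub>R w"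
  have "w \<noteq> 0" using w(2) span_zero by metis
  then have "(2 * norm w) *\<^sub>R v = w" by (simp add: v_def)
  then have "v \<notin> ?W" using w(2) span_scale[of v _ "2 * norm w"] by metis
  moreover have "v \<in> V" "norm v < 1"
    using w(1) V \<open>w \<noteq> 0\<close> by (simp_all add: v_def subspace_scale)
  ultimately have v: "v \<in> V" "v \<notin> ?W" "norm v < 1" by blast+
  have sets_L: "sets (subspace_lebesgue V) = sets borel" by (simp add: subspace_lebesgue_def Let_def)
  have C: "?C \<in> sets borel" using closed_subspace[OF V] by auto
  have Wb: "?W \<in> sets borel" using closed_subspace[OF subspace_span] by auto
  have sgn: "sgn \<in> ?R \<rightarrow>\<^sub>M ?S"
  proof (rule measurable_restrict_space2)
    show "sgn \<in> space ?R \<rightarrow> unit_sphere V"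
      using V by (auto simp: space_restrict_space unit_sphere_def norm_sgn sgn_div_norm subspace_scale)
    show "sgn \<in> ?R \<rightarrow>\<^sub>M borel"
      by (rule measurable_restrict_space1) (simp add: measurable_cong_sets[OF sets_L refl])
  qed
  define bad where "bad = unit_sphere V - ?W"
  have bad: "bad \<in> sets ?S"
    unfolding bad_def sets_restrict_space using Wb by (intro image_eqI[of _ _ "- ?W"]) auto
  have "AE X in sphere_measure V. X \<notin> bad"
    using P
  proof eventually_elim
    case (elim X)
    then show ?case by (auto simp: bad_def intro: span_base)
  qed
  moreover have "bad \<in> sets (sphere_measure V)"
    using bad by (simp add: sphere_measure_def)
  ultimately have "emeasure (sphere_measure V) bad = 0"
    by (simp add: AE_iff_null_sets null_setsD1)
  moreover have "emeasure (sphere_measure V) bad = of_nat (dim V) * emeasure ?R (sgn -` bad \<inter> space ?R)"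
    unfolding sphere_measure_def using bad sgn by (simp add: emeasure_distr)
  \<comment> \<open>The sphere measure carries the factor \<open>dim V\<close>, which has to be
    cancelled.\<close>
  moreover have "dim V \<noteq> 0" using w(1) \<open>w \<noteq> 0\<close> by (auto simp: dim_eq_0)
  ultimately have "emeasure ?R (sgn -` bad \<inter> space ?R) = 0" by simp
  moreover have "sgn -` bad \<inter> space ?R \<in> sets ?R" using sgn bad by (rule measurable_sets)
  then have set1: "sgn -` bad \<inter> space ?R \<in> sets (subspace_lebesgue V)"
    using C sets_L by (subst (asm) sets_restrict_space_iff) auto
  moreover have "emeasure ?R (sgn -` bad \<inter> space ?R) = emeasure (subspace_lebesgue V) (sgn -` bad \<inter> space ?R)"
    using C sets_L by (intro emeasure_restrict_space) (auto simp: space_restrict_space)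
  moreover have "emeasure (subspace_lebesgue V) (sgn -` bad \<inter> space ?R) \<noteq> 0"
  proof (rule emeasure_subspace_lebesgue_pos[OF V, of v "ball 0 1 - ?W"])
    show "sgn -` bad \<inter> space ?R \<in> sets borel" using set1 sets_L by simp
    show "open (ball 0 1 - ?W)" using closed_subspace[OF subspace_span] by auto
    show "V \<inter> (ball 0 1 - ?W) \<subseteq> sgn -` bad \<inter> space ?R"
    proof
      fix u assume u: "u \<in> V \<inter> (ball 0 1 - ?W)"
      then have "u \<noteq> 0" using span_zero by auto
      have "norm u *\<^sub>R sgn u = u" using \<open>u \<noteq> 0\<close> by (simp add: sgn_div_norm)
      moreover have "u \<notin> ?W" using u by blast
      ultimately have "sgn u \<notin> ?W" using span_scale[of "sgn u" _ "norm u"] by metis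
      then show "u \<in> sgn -` bad \<inter> space ?R"
        using u V \<open>u \<noteq> 0\<close> sets_L[THEN sets_eq_imp_space_eq]
        by (auto simp: bad_def unit_sphere_def space_restrict_space norm_sgn sgn_div_norm subspace_scale)
    qed
  qed (use v in auto)
  ultimately show False by simp
qed

section \<open>Carnot groups\<close>

locale carnot_group_with_haar =
  fixes G :: "('g::{t2_space,second_countable_topology}, 'a::euclidean_space) stratified_lie_group"
    and ex :: "'a \<Rightarrow> 'g" and \<mu> :: "'g measure"
  assumes carnot: "carnot_group G" and exp_map: "exponential_map G ex"
    and haar: "haar_measure_on G UNIV \<mu>"
begin

section \<open>Flows of left-invariant fields\<close>

lemma lie: "lie_group G" and coords: "lie_algebra_coordinates G"
  using carnot by (simp_all add: carnot_group_def)

lemma atlas: "smooth_atlas (charts G)" and grp: "group (mul G) (one G) (inver G)"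
  and mul_cont: "continuous_on UNIV (\<lambda>(x, y). mul G x y)"
  using lie by (simp_all add: lie_group_def)

lemmas mul_assoc = semigroup.assoc[OF group.axioms(1)[OF grp]]

lemma mul_one: "mul G x (one G) = x"
proof -
  interpret group "mul G" "one G" "inver G" by (rule grp)
  show ?thesis by (rule right_neutral)
qed

lemma sets_mu: "sets \<mu> = sets borel"
  using haar by (simp add: haar_measure_on_def)

lemma mu_compact: "compact K \<Longrightarrow> emeasure \<mu> K < \<infinity>"
  using haar by (simp add: haar_measure_on_def)

lemma ex_add: "ex ((s + t) *\<^sub>R X) = mul G (ex (s *\<^sub>R X)) (ex (t *\<^sub>R X))"
  and ex_cont: "continuous_on UNIV (\<lambda>t::real. ex (t *\<^sub>R X))"
  and ex_deriv: "f \<in> smooth_functions G \<Longrightarrow>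
    ((\<lambda>t. f (ex (t *\<^sub>R X))) has_real_derivative lvf G X f (one G)) (at 0)"
  using exp_map unfolding exponential_map_def by simp_all

lemma ex_zero: "ex 0 = one G"
proof -
  have "mul G (ex 0) (ex 0) = ex 0" using ex_add[of 0 0 0] by simp
  then have "mul G (ex 0) (ex 0) = mul G (ex 0) (one G)" by (simp add: mul_one)
  then show ?thesis by (simp only: group.left_cancel[OF grp])
qed

definition flow :: "'a \<Rightarrow> 'g \<Rightarrow> real \<Rightarrow> 'g" where
  "flow X x t = mul G x (ex (t *\<^sub>R X))"

lemma flow_add: "flow X (flow X x s) t = flow X x (s + t)"
  by (simp add: flow_def mul_assoc ex_add)

lemma flow_zero: "flow X x 0 = x"
  by (simp add: flow_def ex_zero mul_one)

lemma flow_continuous: "continuous_on UNIV (\<lambda>(x, t). flow X x t)"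
proof -
  have "continuous_on UNIV (\<lambda>p :: 'g \<times> real. ex (snd p *\<^sub>R X))"
    by (rule continuous_on_compose2[OF ex_cont continuous_on_snd[OF continuous_on_id]]) simp
  then have "continuous_on UNIV (\<lambda>p :: 'g \<times> real. (\<lambda>(x, y). mul G x y) (fst p, ex (snd p *\<^sub>R X)))"
    by (intro continuous_on_compose2[OF mul_cont] continuous_on_Pair continuous_on_fst continuous_on_id) auto
  then show ?thesis by (simp add: flow_def case_prod_unfold)
qed

text \<open>The exponential map gives the derivative at the identity. Applied to the left translate
  of \<open>f\<close> by \<open>x\<close>, it gives the derivative at \<open>x\<close>, because
  \<open>lvf G X\<close> commutes with left translations.\<close>

lemma flow_deriv:
  assumes "f \<in> smooth_functions G"
  shows "((\<lambda>t. f (flow X x t)) has_real_derivative lvf G X f x) (at 0)"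
proof -
  have "lvf G X \<in> left_invariant_fields G"
    using coords by (auto simp: lie_algebra_coordinates_def bij_betw_def)
  then have "lvf G X (\<lambda>y. f (mul G x y)) (one G) = lvf G X f (mul G x (one G))"
    using assms unfolding left_invariant_fields_def by (simp add: fun_eq_iff)
  then show ?thesis
    using ex_deriv[OF smooth_functions_left_translate[OF lie assms, of x], of X]
    by (simp add: flow_def mul_one)
qed

lemma lvf_smooth: "f \<in> smooth_functions G \<Longrightarrow> lvf G X f \<in> smooth_functions G"
proof -
  have "lvf G X \<in> left_invariant_fields G"
    using coords by (auto simp: lie_algebra_coordinates_def bij_betw_def)
  then show "f \<in> smooth_functions G \<Longrightarrow> lvf G X f \<in> smooth_functions G"
    by (auto simp: left_invariant_fields_def vector_fields_def)
qed

text \<open>Locality of the derivation is read off from its flow: a curve starting in the open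
  complement of \<open>K\<close> stays there for small times, and \<open>f\<close> vanishes along
  it.\<close>

lemma lvf_support:
  assumes "f \<in> smooth_functions G" "closed K" "\<And>x. x \<notin> K \<Longrightarrow> f x = 0" "x \<notin> K"
  shows "lvf G X f x = 0"
proof -
  have "continuous_on UNIV (\<lambda>t::real. (x, t))" by (intro continuous_intros)
  from continuous_on_compose2[OF flow_continuous this] have "continuous_on UNIV (flow X x)"
    by simp
  then have "open (flow X x -` (- K))" using assms(2) by (intro open_vimage) auto
  then have "((\<lambda>_. 0) has_real_derivative lvf G X f x) (at 0)"
    using assms(3,4) flow_zero
    by (intro has_field_derivative_transform_within_open[OF flow_deriv[OF assms(1)]]) auto
  then show ?thesis by (metis DERIV_const DERIV_unique)
qed

lemma test_functionsD:
  assumes "\<phi> \<in> test_functions G"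
  shows "\<phi> \<in> smooth_functions G" "continuous_on UNIV \<phi>" "continuous_on UNIV (lvf G X \<phi>)"
    "compact (closure {x. \<phi> x \<noteq> 0})" "x \<notin> closure {x. \<phi> x \<noteq> 0} \<Longrightarrow> \<phi> x = 0"
    "x \<notin> closure {x. \<phi> x \<noteq> 0} \<Longrightarrow> lvf G X \<phi> x = 0"
proof -
  show s: "\<phi> \<in> smooth_functions G" and "compact (closure {x. \<phi> x \<noteq> 0})"
    using assms by (auto simp: test_functions_def)
  show "continuous_on UNIV \<phi>" "continuous_on UNIV (lvf G X \<phi>)"
    using smooth_functions_continuous[OF atlas] s lvf_smooth by blast+
  have *: "x \<notin> closure {x. \<phi> x \<noteq> 0} \<Longrightarrow> \<phi> x = 0" for x
    using closure_subset[of "{x. \<phi> x \<noteq> 0}"] by auto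
  then show "x \<notin> closure {x. \<phi> x \<noteq> 0} \<Longrightarrow> \<phi> x = 0" .
  show "x \<notin> closure {x. \<phi> x \<noteq> 0} \<Longrightarrow> lvf G X \<phi> x = 0"
    using lvf_support[OF s closed_closure *] by blast
qed

text \<open>Monotonicity of a line provides some parameterization \<open>(Y, y)\<close>. Equality of
  the orientation rays gives \<open>Y = c *\<^sub>R X\<close> with \<open>c > 0\<close>, equality of
  the images gives a time \<open>s\<close> with \<open>y = flow X x s\<close>, and the resulting
  increasing affine change of time preserves monotonicity and null sets.\<close>

lemma monotone_line_param:
  assumes "monotone_line G ex E (oriented_line G ex X x)" "X \<noteq> 0"
  shows "\<exists>h. (mono h \<or> antimono h) \<and> (AE t in lborel. (indicator E (flow X x t) :: real) = h t)"
proof -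
  obtain Y y h where Y: "oriented_line G ex X x = oriented_line G ex Y y"
    and h: "mono h \<or> antimono h" "AE t in lborel. (indicator E (flow Y y t) :: real) = h t"
    using assms(1) unfolding monotone_line_def flow_def by blast
  have "{c *\<^sub>R X | c. c > 0} = {c *\<^sub>R Y | c. c > 0}" and ran: "range (flow X x) = range (flow Y y)"
    using Y by (auto simp: oriented_line_def flow_def)
  moreover have "Y \<in> {c *\<^sub>R Y | c. c > 0}" by (auto intro: exI[of _ 1])
  ultimately obtain c where c: "Y = c *\<^sub>R X" "c > 0" by blast
  have "y \<in> range (flow Y y)" by (rule range_eqI[of _ _ 0]) (simp add: flow_zero)
  then obtain s where s: "y = flow X x s" unfolding ran[symmetric] by blast
  have "flow Y y t = flow X y (c * t)" for t by (simp add: c(1) flow_def mult.commute)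
  then have fl: "flow Y y t = flow X x (s + c * t)" for t by (simp add: s flow_add)
  define k where "k r = h ((r - s) / c)" for r
  \<comment> \<open>The affine substitution is available for measurable predicates; the exceptional
    set need not be Borel, so it is enclosed in a measurable null set.\<close>
  obtain Z where Z: "{t \<in> space lborel. \<not> (indicator E (flow Y y t) :: real) = h t} \<subseteq> Z" "Z \<in> null_sets lborel"
    using AE_E[OF h(2)] by (metis null_setsI)
  have "AE t in lborel. t \<notin> Z" using Z(2) by (rule AE_not_in)
  then have "AE t in lborel. - s / c + (1 / c) * t \<notin> Z"
    using Z(2) c(2) by (intro AE_borel_affine) auto
  then have "AE t in lborel. (indicator E (flow X x t) :: real) = k t"
  proof eventually_elim
    case (elim t)
    have eq: "- s / c + (1 / c) * t = (t - s) / c" by (simp add: diff_divide_distrib)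
    have "(indicator E (flow Y y ((t - s) / c)) :: real) = h ((t - s) / c)"
      using elim Z(1) unfolding eq by auto
    then show ?case using c(2) by (simp add: fl k_def)
  qed
  moreover have "mono k \<or> antimono k"
    using h(1)
  proof
    assume "mono h"
    then have "mono k" using c(2) by (auto simp: k_def mono_def divide_right_mono)
    then show ?thesis ..
  next
    assume "antimono h"
    then have "antimono k" using c(2) by (auto simp: k_def antimono_def divide_right_mono)
    then show ?thesis ..
  qed
  ultimately show ?thesis by blast
qed

section \<open>Derivatives of the indicator and the conclusion\<close>

lemma flow_disintegration_N:
  assumes "normalized_haar_on_N G ex \<mu> X \<nu>"
  shows "flow_disintegration \<mu> \<nu> (flow X)"
proof
  have m: "(\<lambda>(x, t). flow X x t) \<in> \<nu> \<Otimes>\<^sub>M lborel \<rightarrow>\<^sub>M \<mu>"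
    and d: "distr (\<nu> \<Otimes>\<^sub>M lborel) \<mu> (\<lambda>(x, t). flow X x t) = \<mu>"
    using assms by (auto simp: normalized_haar_on_N_def flow_def)
  show "(\<lambda>(x, t). flow X x t) \<in> \<nu> \<Otimes>\<^sub>M lborel \<rightarrow>\<^sub>M borel"
    using m by (simp add: measurable_cong_sets[OF refl sets_mu])
  have "distr (\<nu> \<Otimes>\<^sub>M lborel) borel (\<lambda>(x, t). flow X x t) = distr (\<nu> \<Otimes>\<^sub>M lborel) \<mu> (\<lambda>(x, t). flow X x t)"
    by (rule distr_cong) (simp_all add: sets_mu)
  with d show "distr (\<nu> \<Otimes>\<^sub>M lborel) borel (\<lambda>(x, t). flow X x t) = \<mu>" by simp
qed (use mu_compact sigma_compact_manifold[OF atlas] flow_continuous flow_add flow_zero in auto)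

lemma integral_over_completion:
  assumes E: "E = S \<union> N" "N \<subseteq> N'" "N' \<in> null_sets \<mu>" "S \<in> sets \<mu>" "E \<in> sets (completion \<mu>)"
    and f: "continuous_on UNIV f"
  shows "(LINT x:E|completion \<mu>. f x :: real) = (LINT x|\<mu>. indicator S x * f x)"
proof -
  have [measurable]: "f \<in> borel_measurable \<mu>"
    unfolding measurable_cong_sets[OF sets_mu refl] using f by (rule borel_measurable_continuous_onI)
  have [measurable]: "f \<in> borel_measurable (completion \<mu>)" by (rule measurable_completion) measurable
  have [measurable]: "S \<in> sets \<mu>" "S \<in> sets (completion \<mu>)" "E \<in> sets (completion \<mu>)" using E by auto
  have "AE x in completion \<mu>. x \<notin> N'" using E(3) by (intro AE_completion AE_not_in)
  then have "AE x in completion \<mu>. indicator E x *\<^sub>R f x = indicator S x * f x"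
    by eventually_elim (use E(1,2) in \<open>auto simp: indicator_def\<close>)
  moreover have "(\<lambda>x. indicator E x *\<^sub>R f x) \<in> borel_measurable (completion \<mu>)"
    "(\<lambda>x. indicator S x * f x) \<in> borel_measurable (completion \<mu>)" by measurable
  ultimately have "(LINT x:E|completion \<mu>. f x) = (LINT x|completion \<mu>. indicator S x * f x)"
    unfolding set_lebesgue_integral_def by (intro integral_cong_AE)
  also have "\<dots> = (LINT x|\<mu>. indicator S x * f x)"
    by (rule integral_completion) measurable
  finally show ?thesis .
qed

text \<open>Monotonicity is known for \<open>E\<close>, while the integration by parts asks for the
  Borel set \<open>S\<close>. Almost every line meets the null set \<open>N'\<close> only for a null
  set of times, so monotonicity passes to \<open>S\<close>.\<close>

lemma signed_radon_good_direction:
  assumes E: "E = S \<union> N" "N \<subseteq> N'" "N' \<in> null_sets \<mu>" "S \<in> sets \<mu>"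
    and X: "X \<noteq> 0" "normalized_haar_on_N G ex \<mu> X \<nu>"
    and mono: "AE x in \<nu>. monotone_line G ex E (oriented_line G ex X x)"
  shows "signed_radon (test_functions G) (\<lambda>\<phi>. - (LINT x|\<mu>. indicator S x * lvf G X \<phi> x))"
proof -
  interpret F: flow_disintegration \<mu> \<nu> "flow X" by (rule flow_disintegration_N[OF X(2)])
  have S: "S \<in> sets borel" using E(4) sets_mu by simp
  have S_mono: "AE x in \<nu>. \<exists>h. (mono h \<or> antimono h) \<and> (AE t in lborel. (indicator S (flow X x t) :: real) = h t)"
    using mono F.null_set_visits[OF E(3)]
  proof eventually_elim
    case (elim x)
    obtain h where h: "mono h \<or> antimono h" "AE t in lborel. (indicator E (flow X x t) :: real) = h t"
      using monotone_line_param[OF elim(1) X(1)] by blast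
    have "AE t in lborel. (indicator S (flow X x t) :: real) = h t"
      using h(2) elim(2)
    proof eventually_elim
      case (elim t)
      then show ?case using E(1,2) by (auto simp: indicator_def)
    qed
    with h(1) show ?case by blast
  qed
  have "- (LINT x|\<mu>. indicator S x * lvf G X \<phi> x) =
      (LINT x|F.jump_measure S. \<phi> x) - (LINT x|F.jump_measure (- S). \<phi> x)"
    if "\<phi> \<in> test_functions G" for \<phi>
    by (rule F.integral_derivative_monotone[OF S S_mono test_functionsD(2-6)[OF that]
          flow_deriv[OF test_functionsD(1)[OF that]]])
  moreover have "- S \<in> sets borel" using S by auto
  ultimately show ?thesis
    unfolding signed_radon_def using F.radon_jump_measure S by blast
qed

lemma subspace_signed_radon:
  assumes S: "S \<in> sets \<mu>"
  shows "subspace {X. signed_radon (test_functions G) (\<lambda>\<phi>. - (LINT x|\<mu>. indicator S x * lvf G X \<phi> x))}"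
proof -
  let ?T = "\<lambda>X \<phi>. - (LINT x|\<mu>. indicator S x * lvf G X \<phi> x)"
  have int: "integrable \<mu> (\<lambda>x. indicator S x * lvf G X \<phi> x)" if "\<phi> \<in> test_functions G" for X \<phi>
  proof -
    have "radon_measure \<mu>" using sets_mu mu_compact by (simp add: radon_measure_def)
    then have "integrable \<mu> (lvf G X \<phi>)"
      by (rule integrable_radon[OF _ test_functionsD(3,4,6)[OF that]])
    from integrable_mult_indicator[OF S this] show ?thesis by simp
  qed
  have lin: "lvf G (a *\<^sub>R X + b *\<^sub>R Y) \<phi> x = a * lvf G X \<phi> x + b * lvf G Y \<phi> x" for a b X Y \<phi> x
    using coords by (simp add: lie_algebra_coordinates_def)
  \<comment> \<open>Additivity in \<open>X\<close> requires both integrals to exist, which is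
    secured on test functions; hence functionals are compared only there.\<close>
  have cong: "signed_radon (test_functions G) T \<longleftrightarrow> signed_radon (test_functions G) T'"
    if "\<And>\<phi>. \<phi> \<in> test_functions G \<Longrightarrow> T \<phi> = T' \<phi>" for T T'
    using that by (simp add: signed_radon_def)
  have C: "continuous_on UNIV \<phi>" "\<exists>K. compact K \<and> (\<forall>x. x \<notin> K \<longrightarrow> \<phi> x = 0)"
    if "\<phi> \<in> test_functions G" for \<phi>
    using test_functionsD[OF that] by blast+
  show ?thesis
    unfolding subspace_def
  proof (intro conjI allI ballI CollectI; (elim CollectE)?)
    have "lvf G 0 \<phi> x = 0" for \<phi> x using lin[of 0 0 0 0] by simp
    then show "signed_radon (test_functions G) (?T 0)" by (simp add: signed_radon_zero)
  next
    fix X Y assume "signed_radon (test_functions G) (?T X)" "signed_radon (test_functions G) (?T Y)"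
    then have "signed_radon (test_functions G) (\<lambda>\<phi>. ?T X \<phi> + ?T Y \<phi>)"
      using C by (intro signed_radon_add) auto
    moreover have "?T (X + Y) \<phi> = ?T X \<phi> + ?T Y \<phi>" if "\<phi> \<in> test_functions G" for \<phi>
      using lin[of 1 X 1 Y] int[OF that] by (simp add: distrib_left)
    ultimately show "signed_radon (test_functions G) (?T (X + Y))" by (subst cong) auto
  next
    fix c X assume "signed_radon (test_functions G) (?T X)"
    then have "signed_radon (test_functions G) (\<lambda>\<phi>. c * ?T X \<phi>)"
      using C by (intro signed_radon_scale) auto
    moreover have "?T (c *\<^sub>R X) \<phi> = c * ?T X \<phi>" for \<phi>
      using lin[of c X 0 0] by (simp add: mult.left_commute)
    ultimately show "signed_radon (test_functions G) (?T (c *\<^sub>R X))" by simp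
  qed
qed

text \<open>Almost every section of the null set \<open>A\<close> of pairs is a null set. The
  measurability clause in \<open>null_set_of_lines\<close> is what turns the vanishing integral into
  this statement.\<close>

lemma AE_monotone_line:
  assumes "null_set_of_lines G ex \<mu> {L \<in> lines G ex. \<not> monotone_line G ex E L}"
  obtains \<nu> where
    "\<And>X. X \<in> unit_sphere (layer G 1) \<Longrightarrow> normalized_haar_on_N G ex \<mu> X (\<nu> X)"
    "AE X in sphere_measure (layer G 1). X \<in> unit_sphere (layer G 1) \<longrightarrow>
       (AE x in \<nu> X. monotone_line G ex E (oriented_line G ex X x))"
proof -
  obtain \<nu> A where \<nu>: "\<And>X. X \<in> unit_sphere (layer G 1) \<Longrightarrow> normalized_haar_on_N G ex \<mu> X (\<nu> X)"
    and A: "A \<in> sets (borel :: ('a \<times> 'g) measure)"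
      "{(X, x). X \<in> unit_sphere (layer G 1) \<and> x \<in> N_sub G ex X \<and>
          oriented_line G ex X x \<in> {L \<in> lines G ex. \<not> monotone_line G ex E L}} \<subseteq> A"
    and meas: "(\<lambda>X. emeasure (\<nu> X) {x \<in> N_sub G ex X. (X, x) \<in> A})
             \<in> borel_measurable (sphere_measure (layer G 1))"
    and int: "(\<integral>\<^sup>+X. emeasure (\<nu> X) {x \<in> N_sub G ex X. (X, x) \<in> A} \<partial>sphere_measure (layer G 1)) = 0"
    using assms unfolding null_set_of_lines_def by blast
  have "AE X in sphere_measure (layer G 1). emeasure (\<nu> X) {x \<in> N_sub G ex X. (X, x) \<in> A} = 0"
    using int by (simp only: nn_integral_0_iff_AE[OF meas])
  then have "AE X in sphere_measure (layer G 1). X \<in> unit_sphere (layer G 1) \<longrightarrow>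
       (AE x in \<nu> X. monotone_line G ex E (oriented_line G ex X x))"
  proof eventually_elim
    case (elim X)
    show ?case
    proof
      assume X: "X \<in> unit_sphere (layer G 1)"
      have sets: "sets (\<nu> X) = sets (restrict_space borel (N_sub G ex X))"
        using \<nu>[OF X] by (simp add: normalized_haar_on_N_def haar_measure_on_def)
      then have space: "space (\<nu> X) = N_sub G ex X"
        by (simp add: sets_eq_imp_space_eq space_restrict_space)
      have "continuous_on UNIV (\<lambda>x::'g. (X, x))" by (intro continuous_intros)
      then have "(\<lambda>x::'g. (X, x)) \<in> borel \<rightarrow>\<^sub>M borel" by (rule borel_measurable_continuous_onI)
      then have "(\<lambda>x::'g. (X, x)) -` A \<inter> space borel \<in> sets borel" using A(1) by (rule measurable_sets)
      \<comment> \<open>A section of a Borel set is Borel in the group, so its trace on the subgroup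
        is measurable for \<nu> X.\<close>
      then have "{x \<in> N_sub G ex X. (X, x) \<in> A} \<in> sets (\<nu> X)"
        unfolding sets sets_restrict_space
        by (rule image_eqI[rotated]) auto
      then have "{x \<in> N_sub G ex X. (X, x) \<in> A} \<in> null_sets (\<nu> X)" using elim by auto
      then show "AE x in \<nu> X. monotone_line G ex E (oriented_line G ex X x)"
      proof (rule AE_I')
        have "oriented_line G ex X x \<in> lines G ex" for x
          using X unfolding lines_def unit_sphere_def by force
        then show "{x \<in> space (\<nu> X). \<not> monotone_line G ex E (oriented_line G ex X x)}
            \<subseteq> {x \<in> N_sub G ex X. (X, x) \<in> A}"
          using A(2) X unfolding space by blast
      qed
    qed
  qed
  with \<nu> show ?thesis by (rule that)
qed

lemma monotone_imp_locally_finite_perimeter: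
  assumes "monotone_set G ex \<mu> E"
  shows "locally_finite_perimeter G \<mu> E"
proof -
  have E: "E \<in> sets (completion \<mu>)"
    and null: "null_set_of_lines G ex \<mu> {L \<in> lines G ex. \<not> monotone_line G ex E L}"
    using assms by (auto simp: monotone_set_def)
  obtain S N N' where S: "E = S \<union> N" "N \<subseteq> N'" "N' \<in> null_sets \<mu>" "S \<in> sets \<mu>"
    using E by (rule sets_completionE)
  let ?V = "layer G 1"
  let ?P = "\<lambda>X. signed_radon (test_functions G) (\<lambda>\<phi>. - (LINT x|\<mu>. indicator S x * lvf G X \<phi> x))"
  obtain \<nu> where \<nu>: "\<And>X. X \<in> unit_sphere ?V \<Longrightarrow> normalized_haar_on_N G ex \<mu> X (\<nu> X)"
    and AE: "AE X in sphere_measure ?V. X \<in> unit_sphere ?V \<longrightarrow>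
       (AE x in \<nu> X. monotone_line G ex E (oriented_line G ex X x))"
    using AE_monotone_line[OF null] by blast
  have "subspace ?V" using carnot by (auto simp: carnot_group_def stratification_def)
  moreover have "AE X in sphere_measure ?V. X \<in> unit_sphere ?V \<longrightarrow> ?P X"
    using AE
  proof eventually_elim
    case (elim X)
    show ?case
    proof
      assume X: "X \<in> unit_sphere ?V"
      then have "X \<noteq> 0" by (auto simp: unit_sphere_def)
      then show "?P X" using signed_radon_good_direction[OF S _ \<nu>[OF X]] elim X by blast
    qed
  qed
  ultimately have "?V \<subseteq> span {X \<in> unit_sphere ?V. X \<in> unit_sphere ?V \<longrightarrow> ?P X}"
    by (rule span_AE_sphere)
  also have "\<dots> \<subseteq> {X. ?P X}"
    by (rule span_minimal[OF _ subspace_signed_radon[OF S(4)]]) blast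
  finally have "?P X" if "X \<in> ?V" for X using that by blast
  moreover have "(LINT x:E|completion \<mu>. lvf G X \<phi> x) = (LINT x|\<mu>. indicator S x * lvf G X \<phi> x)"
    if "\<phi> \<in> test_functions G" for X \<phi>
    using test_functionsD(3)[OF that] by (rule integral_over_completion[OF S E])
  ultimately show ?thesis
    using E unfolding locally_finite_perimeter_def signed_radon_def by simp
qed

end

theorem theorem1p1:
  fixes G :: "('g::{t2_space,second_countable_topology}, 'a::euclidean_space) stratified_lie_group"
    and ex :: "'a \<Rightarrow> 'g"
    and \<mu> :: "'g measure"
    and E :: "'g set"
  assumes "carnot_group G"
    and "exponential_map G ex"
    and "haar_measure_on G UNIV \<mu>"
    and "monotone_set G ex \<mu> E"
  shows "locally_finite_perimeter G \<mu> E"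
proof -
  interpret carnot_group_with_haar G ex \<mu> by (rule carnot_group_with_haar.intro) fact+
  show ?thesis using assms(4) by (rule monotone_imp_locally_finite_perimeter)
qed

end
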